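(* Let $a_1\in\mathbb D$, $a_1'=|1+a_1|-1$, $\gamma_{a_1}=\arg(1+\overline{a_1})$, $0\le\gamma_1,\gamma_2<2\pi$, and let $f_1=h_1+\overline{g_1}\in\mathcal S(H^{a_1}_{\gamma_1})$ with $h_1(z)+e^{-2i(\gamma_1+\gamma_{a_1})}g_1(z)=\frac{(1+a_1')z}{1-e^{i(\gamma_1+\gamma_{a_1})}z}$ and dilatation $$\omega_{f_1}(z)=e^{2i(\gamma_1+\gamma_{a_1})}\frac{a_1'-ze^{i(\gamma_1+\gamma_{a_1})}}{1-a_1'ze^{i(\gamma_1+\gamma_{a_1})}}.$$ Let $f_2=h_2+\overline{g_2}$ be locally univalent with dilatation $\omega_{f_2}(z)=e^{i\theta}z^n$, where $n$ is a positive integer and $\theta\in\mathbb R$. Assume $|1+a_1|\in[\frac{2n}{n+2},2)$. (1) If $f_2\in\mathcal S(H^0_{\gamma_2})$ with $h_2(z)+e^{-2i\gamma_2}g_2(z)=\frac{z}{1-e^{i\gamma_2}z}$, then $f_1*f_2$ is univalent and convex in the direction $-(\gamma_1+\gamma_{a_1}+\gamma_2)$. (2) If $f_2\in\mathcal S(\Omega^0_\beta)$ for some $0<\beta<\pi$, with $h_2(z)+g_2(z)=\frac{1}{2i\sin\beta}\log\left(\frac{1+ze^{i\beta}}{1+ze^{-i\beta}}\right)$, then $f_1*f_2$ is univalent and convex in the direction $-(\gamma_1+\gamma_{a_1})$.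
   Context: $\mathbb D$ is the open unit disk. Harmonic $f=h+\overline g$ on $\mathbb D$ ($h,g$ analytic, $g(0)=0$), dilatation $\omega_f=g'/h'$; $\mathcal H$: those with $h(0)=g(0)=0$, $h'(0)=1$; $\mathcal S_H$: sense-preserving ($|h'|>|g'|$) univalent members of $\mathcal H$. $H^a_\gamma=\{w:\mathrm{Re}(\frac{e^{i\gamma}}{1+a}w)>-\frac12\}$, $\mathcal S(H^a_\gamma)=\{f\in\mathcal S_H:f(\mathbb D)=H^a_\gamma\}$; $\Omega^0_\beta=\{w:\frac{\beta-\pi}{2\sin\beta}<\mathrm{Re}\,w<\frac{\beta}{2\sin\beta}\}$, $\mathcal S(\Omega^0_\beta)=\{f\in\mathcal S_H:f(\mathbb D)=\Omega^0_\beta\}$. Harmonic convolution: $f*F=\sum a_nA_nz^n+\sum\overline{b_nB_n}\,\overline z^n$ for $f=\sum a_nz^n+\sum\overline{b_n}\,\overline z^n$, $F=\sum A_nz^n+\sum\overline{B_n}\,\overline z^n$. A univalent map $f$ is convex in the direction $\alpha$ (modulo $\pi$) if each line parallel to the line through $0$ and $e^{i\alpha}$ meets $f(\mathbb D)$ in an interval or the empty set. Logarithms are principal branches vanishing at $0$. *)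

theory Defs
  imports "HOL-Analysis.Analysis"
begin

text \<open>A harmonic map f = h + conj g on the unit disk is represented by the pair (h, g).\<close>

definition harm :: "(complex \<Rightarrow> complex) \<Rightarrow> (complex \<Rightarrow> complex) \<Rightarrow> complex \<Rightarrow> complex" where
  "harm h g = (\<lambda>z. h z + cnj (g z))"

definition dilatation :: "(complex \<Rightarrow> complex) \<Rightarrow> (complex \<Rightarrow> complex) \<Rightarrow> complex \<Rightarrow> complex" where
  "dilatation h g z = deriv g z / deriv h z"

definition in_SH :: "(complex \<Rightarrow> complex) \<Rightarrow> (complex \<Rightarrow> complex) \<Rightarrow> bool" where
  "in_SH h g \<longleftrightarrow> h holomorphic_on ball 0 1 \<and> g holomorphic_on ball 0 1 \<and>
     h 0 = 0 \<and> g 0 = 0 \<and> deriv h 0 = 1 \<and>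
     (\<forall>z\<in>ball 0 1. norm (deriv g z) < norm (deriv h z)) \<and>
     inj_on (harm h g) (ball 0 1)"

definition halfplane_H :: "complex \<Rightarrow> real \<Rightarrow> complex set" where
  "halfplane_H a \<gamma> = {w. Re (exp (\<i> * of_real \<gamma>) / (1 + a) * w) > - 1/2}"

definition strip_Omega :: "real \<Rightarrow> complex set" where
  "strip_Omega \<beta> = {w. (\<beta> - pi) / (2 * sin \<beta>) < Re w \<and> Re w < \<beta> / (2 * sin \<beta>)}"

definition locally_univalent :: "(complex \<Rightarrow> complex) \<Rightarrow> complex set \<Rightarrow> bool" where
  "locally_univalent f S \<longleftrightarrow> (\<forall>z\<in>S. \<exists>e>0. inj_on f (ball z e \<inter> S))"

definition taylor_coeff :: "(complex \<Rightarrow> complex) \<Rightarrow> nat \<Rightarrow> complex" where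
  "taylor_coeff h n = (deriv ^^ n) h 0 / fact n"

definition hadamard :: "(complex \<Rightarrow> complex) \<Rightarrow> (complex \<Rightarrow> complex) \<Rightarrow> complex \<Rightarrow> complex" where
  "hadamard h H z = (\<Sum>n. taylor_coeff h n * taylor_coeff H n * z ^ n)"

definition harm_conv :: "(complex \<Rightarrow> complex) \<Rightarrow> (complex \<Rightarrow> complex) \<Rightarrow>
    (complex \<Rightarrow> complex) \<Rightarrow> (complex \<Rightarrow> complex) \<Rightarrow> complex \<Rightarrow> complex" where
  "harm_conv h1 g1 h2 g2 = harm (hadamard h1 h2) (hadamard g1 g2)"

definition convex_in_direction :: "(complex \<Rightarrow> complex) \<Rightarrow> complex set \<Rightarrow> real \<Rightarrow> bool" where
  "convex_in_direction f S \<alpha> \<longleftrightarrow>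
     (\<forall>w. is_interval {t::real. w + of_real t * exp (\<i> * of_real \<alpha>) \<in> f ` S})"

end

theory Submission
  imports Defs "HOL-Complex_Analysis.Complex_Analysis" "HOL-Real_Asymp.Real_Asymp"
begin

text \<open>
  Put \<open>\<mu> = exp (\<i> (\<gamma>1 + \<gamma>a))\<close> and \<open>b = 1 - a1'\<close>. The data of \<open>f1\<close> force \<open>h1\<close> and \<open>g1\<close> to be combinations of
  \<open>z / (1 - \<mu> z)\<close> and \<open>z / (1 - \<mu> z)\<^sup>2\<close>, so the convolution at \<open>z / \<mu>\<close> is, up to the factor \<open>1 / \<mu>\<close>, the
  harmonic map with parts \<open>((2 - b) h2 + b z h2') / 2\<close> and \<open>((2 - b) g2 - b z g2') / 2\<close>.

  The (rotated) shear \<open>h2 + g2\<close> of \<open>f2\<close> maps the disk onto a half-plane or vertical strip; take its value \<open>w\<close> as the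
  coordinate. With \<open>\<Theta>\<close> the dilatation of \<open>f2\<close> and \<open>W = z / (dz/dw)\<close>, the parts \<open>p\<close>, \<open>q\<close> of the convolution satisfy
  \<open>2 (1 + \<Theta>) p' = k + X\<close> and \<open>2 (1 + \<Theta>) q' = \<Theta> (k - X)\<close>, where \<open>X = b W' + (b n / 2) (1 - \<Theta>) / (1 + \<Theta>)\<close> has positive
  real part and \<open>k = (4 - b (n + 2)) / 2\<close>; the hypothesis on \<open>a1\<close> says exactly \<open>k \<ge> 0\<close>, whence \<open>|q'| < |p'|\<close>.
  Moreover \<open>Re (p' - q') > 0\<close>, so \<open>Im (p - q)\<close> increases along vertical lines and meets each of them in every value:
  each of its level curves is a graph over the base interval, along which \<open>Re (p + q)\<close> is strictly monotone
  because the Jacobian is positive. This gives univalence and convexity in the horizontal direction together.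
\<close>

section \<open>Harmonic maps on vertical strips: level curves and monotonicity along them\<close>

text \<open>Moving along \<open>y\<close> multiplies the derivative by \<open>\<i>\<close>, and the
  imaginary part of \<open>\<i> * f'\<close> is \<open>Re f'\<close>.\<close>

lemma Im_vertical_derivative:
  assumes "(f has_field_derivative f') (at (Complex x y))"
  shows "((\<lambda>y. Im (f (Complex x y))) has_real_derivative Re f') (at y)"
proof -
  have "((\<lambda>y. of_real x + \<i> * of_real y) has_derivative (\<lambda>v. \<i> * of_real v)) (at y)"
    by (auto intro!: derivative_eq_intros)
  from has_derivative_compose[OF this assms[unfolded has_field_derivative_def Complex_eq]]
  have "((\<lambda>y. Im (f (of_real x + \<i> * of_real y))) has_derivative (\<lambda>v. Im (f' * (\<i> * of_real v)))) (at y)"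
    by (rule has_derivative_Im)
  then show ?thesis by (simp add: has_field_derivative_def Complex_eq)
qed

text \<open>The pair \<open>(Re w, V w)\<close> serves as coordinates: by \<open>pos\<close> and
  \<open>onto\<close> it maps the domain bijectively onto \<open>X\<close> times the real line.
  Since \<open>Im (harm p q w) = V w\<close>, the harmonic map keeps the second coordinate, so only
  strict monotonicity in the first one remains, and \<open>jac\<close> supplies it.\<close>

lemma horizontal_shear:
  fixes p q p' q' :: "complex \<Rightarrow> complex" and X :: "real set"
  assumes X: "open X" "is_interval X"
    and p: "\<And>w. Re w \<in> X \<Longrightarrow> (p has_field_derivative p' w) (at w)"
    and q: "\<And>w. Re w \<in> X \<Longrightarrow> (q has_field_derivative q' w) (at w)"
    and jac: "\<And>w. Re w \<in> X \<Longrightarrow> norm (q' w) < norm (p' w)"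
    and pos: "\<And>w. Re w \<in> X \<Longrightarrow> Re (p' w - q' w) > 0"
    and onto: "\<And>x t. x \<in> X \<Longrightarrow> \<exists>y. Im (p (Complex x y) - q (Complex x y)) = t"
  shows "inj_on (harm p q) {w. Re w \<in> X}"
    and "convex_in_direction (harm p q) {w. Re w \<in> X} 0"
proof -
  define \<Omega> where "\<Omega> = {w. Re w \<in> X}"
  define V where "V w = Im (p w - q w)" for w
  define \<Phi> where "\<Phi> w = Complex (Re w) (V w)" for w
  define \<Psi> where "\<Psi> = inv_into \<Omega> \<Phi>"
  \<comment> \<open>\<open>\<Phi>\<close> straightens the level curves of \<open>V\<close>; \<open>E t\<close> is the real part of the harmonic map along \<open>V = t\<close>.\<close>
  define E where "E t x = Re (p (\<Psi> (Complex x t)) + q (\<Psi> (Complex x t)))" for t x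
  have \<Omega>_eq: "\<Omega> = Re -` X" by (auto simp: \<Omega>_def)
  have op: "open \<Omega>"
    unfolding \<Omega>_eq by (rule open_vimage[OF X(1)]) (intro continuous_intros)
  have V': "(V has_derivative (\<lambda>v. Im ((p' w - q' w) * v))) (at w)" if "w \<in> \<Omega>" for w
    using p[of w] q[of w] that unfolding V_def \<Omega>_def has_field_derivative_def
    by (auto intro!: derivative_eq_intros simp: algebra_simps)
  have incr: "V (Complex x y1) < V (Complex x y2)" if x: "x \<in> X" and "y1 < y2" for x y1 y2
  proof (rule DERIV_pos_imp_increasing[OF \<open>y1 < y2\<close>])
    fix y
    have "((\<lambda>y. V (Complex x y)) has_real_derivative Re (p' (Complex x y) - q' (Complex x y))) (at y)"
      unfolding V_def using x
      by (intro Im_vertical_derivative DERIV_diff p q) auto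
    then show "\<exists>d. ((\<lambda>y. V (Complex x y)) has_real_derivative d) (at y) \<and> 0 < d"
      using pos[of "Complex x y"] x by auto
  qed
  have inj: "inj_on \<Phi> \<Omega>"
  proof (rule inj_onI)
    fix w1 w2 assume "w1 \<in> \<Omega>" "w2 \<in> \<Omega>" "\<Phi> w1 = \<Phi> w2"
    then show "w1 = w2"
      using incr[of "Re w1" "Im w1" "Im w2"] incr[of "Re w1" "Im w2" "Im w1"]
      by (cases w1; cases w2; cases "Im w1" "Im w2" rule: linorder_cases)
         (auto simp: \<Phi>_def \<Omega>_def)
  qed
  have \<Psi>\<Phi>: "\<Psi> (\<Phi> w) = w" if "w \<in> \<Omega>" for w
    using that inj by (simp add: \<Psi>_def)
  have surj: "\<Psi> (Complex x t) \<in> \<Omega> \<and> \<Phi> (\<Psi> (Complex x t)) = Complex x t" if "x \<in> X" for x t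
  proof -
    obtain y where y: "V (Complex x y) = t" using onto[OF \<open>x \<in> X\<close>] unfolding V_def by blast
    then have "\<Phi> (Complex x y) = Complex x t" "Complex x y \<in> \<Omega>" using that by (auto simp: \<Phi>_def \<Omega>_def)
    then have "Complex x t \<in> \<Phi> ` \<Omega>" by (metis imageI)
    then show ?thesis unfolding \<Psi>_def by (simp add: inv_into_into f_inv_into_f)
  qed
  have E': "(E t has_field_derivative ((norm (p' w))\<^sup>2 - (norm (q' w))\<^sup>2) / Re (p' w - q' w)) (at x)"
    if x: "x \<in> X" and w_def: "w = \<Psi> (Complex x t)" for x t w
  proof -
    have w: "w \<in> \<Omega>" and \<Phi>w: "\<Phi> w = Complex x t" using surj[OF x] w_def by auto
    define d where "d = p' w - q' w"
    have d: "Re d > 0" using pos[of w] w by (simp add: d_def \<Omega>_def)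
    have \<Phi>': "(\<Phi> has_derivative (\<lambda>v. of_real (Re v) + \<i> * of_real (Im (d * v)))) (at z)"
      if "z = w" for z
      unfolding \<Phi>_def Complex_eq d_def that using V'[OF w]
      by (auto intro!: derivative_eq_intros)
    have "continuous_on \<Omega> \<Phi>"
      unfolding \<Phi>_def Complex_eq
      using V' by (intro continuous_intros has_derivative_continuous_on[where f'="\<lambda>w v. Im ((p' w - q' w) * v)"])
         (auto intro: has_derivative_at_withinI)
    \<comment> \<open>The differential of \<open>\<Phi>\<close> has second component
      \<open>Re d * Im v + Im d * Re v\<close>; solving for \<open>Im v\<close>, possible as
      \<open>Re d > 0\<close>, gives the differential of the inverse.\<close>
    then have \<Psi>': "(\<Psi> has_derivative (\<lambda>v. of_real (Re v) + \<i> * of_real ((Im v - Im d * Re v) / Re d))) (at (\<Phi> w))"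
      using d by (intro has_derivative_inverse_strong[OF op w _ \<Psi>\<Phi> \<Phi>'])
         (auto simp: fun_eq_iff complex_eq_iff field_simps)
    have "((\<lambda>x. of_real x + \<i> * of_real t) has_derivative of_real) (at x)"
      by (auto intro!: derivative_eq_intros)
    from has_derivative_compose[OF this \<Psi>'[unfolded \<Phi>w Complex_eq]]
    have \<Psi>x: "((\<lambda>x. \<Psi> (Complex x t)) has_derivative (\<lambda>v. of_real v + \<i> * of_real (- Im d * v / Re d))) (at x)"
      by (simp add: Complex_eq)
    have "((\<lambda>z. Re (p z + q z)) has_derivative (\<lambda>v. Re ((p' w + q' w) * v))) (at (\<Psi> (Complex x t)))"
      unfolding w_def[symmetric]
      using p[of w] q[of w] w unfolding \<Omega>_def has_field_derivative_def
      by (auto intro!: derivative_eq_intros simp: algebra_simps)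
    from has_derivative_compose[OF \<Psi>x this]
    have 1: "(E t has_derivative (\<lambda>v. Re ((p' w + q' w) * (of_real v + \<i> * of_real (- Im d * v / Re d))))) (at x)"
      by (simp add: E_def[abs_def])
    \<comment> \<open>Along a level curve the velocity is \<open>1 - \<i> * Im d / Re d\<close>, a
      positive multiple of \<open>cnj d\<close>, and the real part of
      \<open>(p' + q') * cnj (p' - q')\<close> is the Jacobian.\<close>
    have "(norm (p' w))\<^sup>2 - (norm (q' w))\<^sup>2 = Re (p' w + q' w) * Re d + Im (p' w + q' w) * Im d"
      unfolding cmod_power2 by (simp add: d_def power2_eq_square algebra_simps)
    then have 2: "Re ((p' w + q' w) * (of_real v + \<i> * of_real (- Im d * v / Re d)))
        = ((norm (p' w))\<^sup>2 - (norm (q' w))\<^sup>2) / Re d * v" for v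
      using d by (simp add: field_simps)
    show ?thesis using 1 unfolding 2 unfolding has_field_derivative_def d_def .
  qed
  have Emono: "E t x1 < E t x2" if "x1 \<in> X" "x2 \<in> X" "x1 < x2" for x1 x2 t
  proof (rule DERIV_pos_imp_increasing[OF \<open>x1 < x2\<close>])
    fix x assume "x1 \<le> x" "x \<le> x2"
    then have x: "x \<in> X" using X(2) that by (metis is_interval_1)
    define w where "w = \<Psi> (Complex x t)"
    have "Re w \<in> X" using surj[OF x] by (simp add: w_def \<Omega>_def)
    then have "((norm (p' w))\<^sup>2 - (norm (q' w))\<^sup>2) / Re (p' w - q' w) > 0"
      using jac pos by (intro divide_pos_pos) (auto simp: power_strict_mono)
    then show "\<exists>y. (E t has_real_derivative y) (at x) \<and> 0 < y"
      using E'[OF x w_def] by blast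
  qed
  have harm_eq: "harm p q w = Complex (E (V w) (Re w)) (V w)" if "w \<in> \<Omega>" for w
  proof -
    have "\<Psi> (Complex (Re w) (V w)) = w" using \<Psi>\<Phi>[OF that] by (simp only: \<Phi>_def)
    then have "E (V w) (Re w) = Re (p w + q w)" by (simp only: E_def)
    then show ?thesis by (simp add: harm_def V_def complex_eq_iff)
  qed
  show "inj_on (harm p q) {w. Re w \<in> X}"
  proof (rule inj_onI, fold \<Omega>_def)
    fix w1 w2 assume w: "w1 \<in> \<Omega>" "w2 \<in> \<Omega>" "harm p q w1 = harm p q w2"
    then have V: "V w1 = V w2" and E: "E (V w1) (Re w1) = E (V w1) (Re w2)"
      by (auto simp: harm_eq)
    have "Re w1 = Re w2"
      using Emono[of "Re w1" "Re w2" "V w1"] Emono[of "Re w2" "Re w1" "V w1"] E w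
      by (cases "Re w1" "Re w2" rule: linorder_cases) (auto simp: \<Omega>_def)
    with V have "\<Phi> w1 = \<Phi> w2" by (simp add: \<Phi>_def)
    then show "w1 = w2" using inj w by (auto dest: inj_onD)
  qed
  show "convex_in_direction (harm p q) {w. Re w \<in> X} 0"
    unfolding convex_in_direction_def
  proof (rule allI, fold \<Omega>_def)
    fix c
    \<comment> \<open>By \<open>surj\<close> the level curve \<open>V = Im c\<close> passes over
      every point of \<open>X\<close>, so the horizontal slice through \<open>c\<close> is the full
      image of \<open>X\<close> under \<open>E (Im c)\<close>, shifted by
      \<open>Re c\<close>.\<close>
    have *: "Complex (Re c + t) (Im c) \<in> harm p q ` \<Omega> \<longleftrightarrow> t \<in> (\<lambda>x. E (Im c) x - Re c) ` X" for t
    proof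
      assume "Complex (Re c + t) (Im c) \<in> harm p q ` \<Omega>"
      then obtain w where "w \<in> \<Omega>" "Complex (Re c + t) (Im c) = Complex (E (V w) (Re w)) (V w)"
        by (auto simp: harm_eq)
      then show "t \<in> (\<lambda>x. E (Im c) x - Re c) ` X"
        by (intro image_eqI[of _ _ "Re w"]) (auto simp: \<Omega>_def)
    next
      assume "t \<in> (\<lambda>x. E (Im c) x - Re c) ` X"
      then obtain x where x: "x \<in> X" "t = E (Im c) x - Re c" by auto
      define w where "w = \<Psi> (Complex x (Im c))"
      have "w \<in> \<Omega>" "Re w = x" "V w = Im c" using surj[OF x(1), of "Im c"] by (auto simp: w_def \<Phi>_def)
      then show "Complex (Re c + t) (Im c) \<in> harm p q ` \<Omega>"
        using x(2) by (intro image_eqI[of _ _ w]) (auto simp: harm_eq)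
    qed
    have "continuous_on X (\<lambda>x. E (Im c) x - Re c)"
      using E' by (intro continuous_intros continuous_at_imp_continuous_on) (blast intro: DERIV_isCont)
    then have "is_interval ((\<lambda>x. E (Im c) x - Re c) ` X)"
      using X(2) by (simp add: is_interval_connected_1 connected_continuous_image)
    moreover have "{t. c + of_real t * exp (\<i> * of_real 0) \<in> harm p q ` \<Omega>} = (\<lambda>x. E (Im c) x - Re c) ` X"
      using * by (auto simp: complex_eq_iff set_eq_iff simp flip: *)
    ultimately show "is_interval {t. c + of_real t * exp (\<i> * of_real 0) \<in> harm p q ` \<Omega>}" by simp
  qed
qed

section \<open>Dilatation and shear of the convolution in the strip coordinate\<close>

lemma Cayley_pos:
  fixes u :: complex
  assumes "norm u < 1"
  shows "Re ((1 - u) / (1 + u)) > 0"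
proof -
  have "1 + u \<noteq> 0" using assms by (metis add_eq_0_iff norm_minus_cancel norm_one less_irrefl)
  moreover have "Re ((1 - u) * cnj (1 + u)) = 1 - (norm u)\<^sup>2"
    unfolding cmod_power2 by (simp add: power2_eq_square algebra_simps)
  moreover have "(norm u)\<^sup>2 < 1" using assms by (simp add: power_less_one_iff)
  ultimately show ?thesis
    by (simp add: Re_complex_div_gt_0)
qed

text \<open>The squared norms differ by \<open>4 * k * Re X\<close>. For \<open>k = 0\<close> they
  agree, so a strict Jacobian inequality has to draw its strictness from
  \<open>norm \<Theta> < 1\<close>.\<close>

lemma norm_diff_less_norm_add:
  fixes X :: complex and k :: real
  assumes "k \<ge> 0" "Re X > 0"
  shows "norm (of_real k - X) \<le> norm (of_real k + X)" "of_real k + X \<noteq> 0"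
proof -
  have "(norm (of_real k - X))\<^sup>2 \<le> (norm (of_real k + X))\<^sup>2"
    using assms unfolding cmod_power2 by (simp add: power2_eq_square algebra_simps)
  then show "norm (of_real k - X) \<le> norm (of_real k + X)" by (simp add: power2_le_iff_abs_le)
  show "of_real k + X \<noteq> 0" using assms by (auto simp: complex_eq_iff)
qed

text \<open>\<open>WT\<close> is the chain rule for \<open>\<Theta>\<close> a constant multiple of
  the n-th power of z, with \<open>W\<close> equal to z divided by dz/dw. It eliminates
  \<open>W * \<Theta>'\<close>, after which \<open>p'\<close> and \<open>q'\<close> are
  \<open>k + X\<close> and \<open>\<Theta> * (k - X)\<close> over the same denominator.\<close>

lemma
  fixes W \<Theta> W' \<Theta>' :: complex and b :: real and n :: nat
  assumes b: "0 < b" "b * (n + 2) \<le> 4"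
    and \<Theta>: "norm \<Theta> < 1" and WT: "W * \<Theta>' = of_nat n * \<Theta>" and W': "Re W' > 0"
  defines "p' \<equiv> ((2 - b) * (1 / (1 + \<Theta>)) + b * ((W' * (1 + \<Theta>) - W * \<Theta>') / (1 + \<Theta>)\<^sup>2)) / 2"
    and "q' \<equiv> ((2 - b) * (\<Theta> / (1 + \<Theta>)) - b * (((W' * \<Theta> + W * \<Theta>') * (1 + \<Theta>) - W * \<Theta> * \<Theta>') / (1 + \<Theta>)\<^sup>2)) / 2"
  shows convolution_dilatation: "norm q' < norm p'"
    and convolution_shear: "p' - q' = ((2 - b) * ((1 - \<Theta>) / (1 + \<Theta>)) + b * W') / 2"
proof -
  define m where "m = (1 - \<Theta>) / (1 + \<Theta>)"
  define k where "k = (4 - b * (n + 2)) / 2"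
  define X where "X = b * W' + (b * n / 2) * m"
  define T where "T = 1 + \<Theta>"
  \<comment> \<open>With \<open>\<Theta>\<close> written as \<open>T - 1\<close>, the rational
    identities below have powers of \<open>T\<close> as their only denominators.\<close>
  have T: "\<Theta> = T - 1" by (simp add: T_def)
  have nz: "T \<noteq> 0" unfolding T_def using \<Theta> by (metis add_eq_0_iff norm_minus_cancel norm_one less_irrefl)
  have m: "Re m > 0" using Cayley_pos[OF \<Theta>] by (simp add: m_def)
  have X: "Re X > 0" using b m W' by (simp add: X_def add_pos_nonneg)
  have k: "k \<ge> 0" using b by (simp add: k_def)
  have p: "p' = (of_real k + X) / (2 * T)"
    unfolding p'_def WT unfolding T using nz
    by (simp add: k_def X_def m_def T divide_simps power2_eq_square) (simp add: algebra_simps)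
  \<comment> \<open>The products are regrouped so that \<open>W * \<Theta>'\<close> appears
    literally and \<open>WT\<close> can replace it.\<close>
  have q: "q' = \<Theta> * ((of_real k - X) / (2 * T))"
    unfolding q'_def distrib_right mult.assoc[of W] mult.commute[of \<Theta> \<Theta>'] mult.assoc[of W, symmetric] WT unfolding T using nz
    by (simp add: k_def X_def m_def T divide_simps power2_eq_square) (simp add: algebra_simps)
  note N = norm_diff_less_norm_add[OF k X]
  have "norm q' = norm \<Theta> * norm ((of_real k - X) / (2 * T))"
    unfolding q norm_mult by simp
  also have "\<dots> \<le> norm \<Theta> * norm p'"
    unfolding p norm_divide using N(1) by (intro mult_left_mono divide_right_mono) auto
  also have "\<dots> < norm p'"
    using \<Theta> N(2) nz by (simp add: p)
  finally show "norm q' < norm p'" .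
  show "p' - q' = ((2 - b) * ((1 - \<Theta>) / (1 + \<Theta>)) + b * W') / 2"
    unfolding p q using nz by (simp add: k_def X_def m_def T divide_simps) (simp add: algebra_simps)
qed

text \<open>Here \<open>p - q = ((2 - b) * (H - G) + b * W) / 2\<close>. Both summands have
  nondecreasing imaginary part on upward vertical lines, and \<open>top\<close> and
  \<open>bot\<close> make the second one unbounded in both directions; this yields
  \<open>pos\<close> and \<open>onto\<close> of \<open>horizontal_shear\<close>.\<close>

lemma convolution_on_strip:
  fixes H G W \<Theta> W' \<Theta>' :: "complex \<Rightarrow> complex" and b :: real and n :: nat and X :: "real set"
  assumes X: "open X" "is_interval X"
    and b: "0 < b" "b * (n + 2) \<le> 4"
    and H: "\<And>w. Re w \<in> X \<Longrightarrow> (H has_field_derivative 1 / (1 + \<Theta> w)) (at w)"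
    and G: "\<And>w. Re w \<in> X \<Longrightarrow> (G has_field_derivative \<Theta> w / (1 + \<Theta> w)) (at w)"
    and W: "\<And>w. Re w \<in> X \<Longrightarrow> (W has_field_derivative W' w) (at w)"
    and \<Theta>': "\<And>w. Re w \<in> X \<Longrightarrow> (\<Theta> has_field_derivative \<Theta>' w) (at w)"
    and \<Theta>: "\<And>w. Re w \<in> X \<Longrightarrow> norm (\<Theta> w) < 1"
    and WT: "\<And>w. Re w \<in> X \<Longrightarrow> W w * \<Theta>' w = of_nat n * \<Theta> w"
    and W': "\<And>w. Re w \<in> X \<Longrightarrow> Re (W' w) > 0"
    and top: "\<And>x. x \<in> X \<Longrightarrow> filterlim (\<lambda>y. Im (W (Complex x y))) at_top at_top"
    and bot: "\<And>x. x \<in> X \<Longrightarrow> filterlim (\<lambda>y. Im (W (Complex x y))) at_bot at_bot"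
  defines "p \<equiv> (\<lambda>w. ((2 - b) * H w + b * (W w / (1 + \<Theta> w))) / 2)"
    and "q \<equiv> (\<lambda>w. ((2 - b) * G w - b * (W w * \<Theta> w / (1 + \<Theta> w))) / 2)"
  shows "inj_on (harm p q) {w. Re w \<in> X}"
    and "convex_in_direction (harm p q) {w. Re w \<in> X} 0"
proof -
  define p' where "p' w = ((2 - b) * (1 / (1 + \<Theta> w)) + b * ((W' w * (1 + \<Theta> w) - W w * \<Theta>' w) / (1 + \<Theta> w)\<^sup>2)) / 2" for w
  define q' where "q' w = ((2 - b) * (\<Theta> w / (1 + \<Theta> w)) - b * (((W' w * \<Theta> w + W w * \<Theta>' w) * (1 + \<Theta> w) - W w * \<Theta> w * \<Theta>' w) / (1 + \<Theta> w)\<^sup>2)) / 2" for w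
  have nz: "1 + \<Theta> w \<noteq> 0" if "Re w \<in> X" for w
    using \<Theta>[OF that] by (metis add_eq_0_iff norm_minus_cancel norm_one less_irrefl)
  \<comment> \<open>The bound \<open>b \<le> 2\<close> makes the weight \<open>2 - b\<close> of
    \<open>H - G\<close> nonnegative.\<close>
  have "b * 2 \<le> b * (n + 2)" using b by simp
  with b have b2: "b \<le> 2" by linarith
  have p: "(p has_field_derivative p' w) (at w)" if w: "Re w \<in> X" for w
    unfolding p_def p'_def
    by (rule DERIV_cong, (rule H[OF w] W[OF w] \<Theta>'[OF w] nz[OF w]
        DERIV_const DERIV_cdivide DERIV_cmult DERIV_add DERIV_diff DERIV_divide DERIV_mult)+)
       (simp add: power2_eq_square add.commute mult.commute)
  have q: "(q has_field_derivative q' w) (at w)" if w: "Re w \<in> X" for w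
    unfolding q_def q'_def
    by (rule DERIV_cong, (rule G[OF w] W[OF w] \<Theta>'[OF w] nz[OF w]
        DERIV_const DERIV_cdivide DERIV_cmult DERIV_add DERIV_diff DERIV_divide DERIV_mult)+)
       (simp add: power2_eq_square add.commute mult.commute)
  have jac: "norm (q' w) < norm (p' w)" if w: "Re w \<in> X" for w
    unfolding p'_def q'_def by (rule convolution_dilatation[OF b \<Theta> WT W']) (use w in auto)
  have diff: "p' w - q' w = ((2 - b) * ((1 - \<Theta> w) / (1 + \<Theta> w)) + b * W' w) / 2" if w: "Re w \<in> X" for w
    unfolding p'_def q'_def by (rule convolution_shear[OF b \<Theta> WT W']) (use w in auto)
  have pos: "Re (p' w - q' w) > 0" if w: "Re w \<in> X" for w
    using b b2 W'[OF w] less_imp_le[OF Cayley_pos[OF \<Theta>[OF w]]]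
    unfolding diff[OF w]
    by (simp add: add_nonneg_pos del: times_divide_eq_right flip: of_real_diff)
  have onto: "\<exists>y. Im (p (Complex x y) - q (Complex x y)) = t" if x: "x \<in> X" for x t
  proof -
    \<comment> \<open>Only monotonicity is available for \<open>k\<close>, so the growth of
      \<open>v\<close> must come from \<open>W\<close>.\<close>
    define k where "k y = Im (H (Complex x y) - G (Complex x y))" for y
    define v where "v y = Im (p (Complex x y) - q (Complex x y))" for y
    have k': "(k has_real_derivative Re (1 / (1 + \<Theta> (Complex x y)) - \<Theta> (Complex x y) / (1 + \<Theta> (Complex x y)))) (at y)" for y
      unfolding k_def using x by (intro Im_vertical_derivative DERIV_diff H G) auto
    have k_mono: "k y1 \<le> k y2" if "y1 \<le> y2" for y1 y2
    proof (rule DERIV_nonneg_imp_nondecreasing[OF that])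
      fix y
      show "\<exists>d. (k has_real_derivative d) (at y) \<and> 0 \<le> d"
        using k'[of y] Cayley_pos[OF \<Theta>, of "Complex x y"] x by (auto simp: diff_divide_distrib)
    qed
    have v_eq: "v y = ((2 - b) * k y + b * Im (W (Complex x y))) / 2" for y
    proof -
      have "p w - q w = ((2 - b) * (H w - G w) + b * W w) / 2" if "Re w \<in> X" for w
      proof -
        have "W w / (1 + \<Theta> w) + W w * \<Theta> w / (1 + \<Theta> w) = W w"
          using nz[OF that] by (simp add: divide_simps) (simp add: algebra_simps)
        moreover have "p w - q w = ((2 - b) * (H w - G w) + b * (W w / (1 + \<Theta> w) + W w * \<Theta> w / (1 + \<Theta> w))) / 2"
          by (simp add: p_def q_def algebra_simps add_divide_distrib diff_divide_distrib)
        ultimately show ?thesis by simp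
      qed
      from this[of "Complex x y"] x show ?thesis
        unfolding v_def by (simp only: complex.sel) (simp add: k_def flip: of_real_diff)
    qed
    have v': "(v has_real_derivative Re (p' (Complex x y) - q' (Complex x y))) (at y)" for y
      unfolding v_def using x by (intro Im_vertical_derivative DERIV_diff p q) auto
    have cont: "continuous_on A v" for A
      by (blast intro: continuous_at_imp_continuous_on DERIV_isCont v')
    \<comment> \<open>The threshold is the value of \<open>Im W\<close> that would give
      \<open>v y = t\<close> if \<open>k y\<close> were \<open>k 0\<close>. Since
      \<open>k y \<ge> k 0\<close> for \<open>y \<ge> 0\<close>, and the reverse for
      \<open>y \<le> 0\<close>, the error has the favourable sign on both sides.\<close>
    have "eventually (\<lambda>y. y \<ge> 0 \<and> Im (W (Complex x y)) \<ge> (2 * t - (2 - b) * k 0) / b) at_top"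
      using top[OF x] by (intro eventually_conj eventually_ge_at_top) (simp add: filterlim_at_top)
    then obtain y1 where y1: "y1 \<ge> 0" "Im (W (Complex x y1)) \<ge> (2 * t - (2 - b) * k 0) / b"
      by (auto dest!: eventually_happens)
    have "eventually (\<lambda>y. y \<le> 0 \<and> Im (W (Complex x y)) \<le> (2 * t - (2 - b) * k 0) / b) at_bot"
      using bot[OF x] by (intro eventually_conj eventually_le_at_bot) (simp add: filterlim_at_bot)
    then obtain y2 where y2: "y2 \<le> 0" "Im (W (Complex x y2)) \<le> (2 * t - (2 - b) * k 0) / b"
      by (auto dest!: eventually_happens)
    have "(2 - b) * k 0 \<le> (2 - b) * k y1" "(2 - b) * k y2 \<le> (2 - b) * k 0"
      using b2 y1 y2 by (auto intro!: mult_left_mono k_mono)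
    then have "t \<le> v y1" "v y2 \<le> t"
      using y1(2) y2(2) b(1) unfolding v_eq by (simp_all add: field_simps)
    then show ?thesis
      using IVT'[of v y2 t y1] cont y1 y2 unfolding v_def by force
  qed
  show "inj_on (harm p q) {w. Re w \<in> X}" "convex_in_direction (harm p q) {w. Re w \<in> X} 0"
    by (rule horizontal_shear[OF X p q jac pos onto]; assumption)+
qed

section \<open>Taylor coefficients and Hadamard products with half-plane and Koebe functions\<close>

lemma taylor_coeff_eqI:
  assumes "\<And>z. norm z < 1 \<Longrightarrow> (\<lambda>n. c n * z ^ n) sums f z"
  shows "taylor_coeff f n = c n"
proof -
  have "eventually (\<lambda>z::complex. z \<in> ball 0 1) (nhds 0)"
    by (intro eventually_nhds_in_open) auto
  then have "eventually (\<lambda>z. (\<lambda>n. fps_nth (Abs_fps c) n * z ^ n) sums f z) (nhds 0)"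
    by eventually_elim (simp add: assms)
  then show ?thesis
    using fps_nth_fps_expansion[OF has_fps_expansionI] by (metis taylor_coeff_def fps_nth_Abs_fps)
qed

lemma taylor_coeff_sums:
  assumes "h holomorphic_on ball 0 1" "norm z < 1"
  shows "(\<lambda>n. taylor_coeff h n * z ^ n) sums h z"
  using holomorphic_power_series[OF assms(1), of z] assms(2) by (simp add: taylor_coeff_def)

lemma taylor_coeff_deriv_sums:
  assumes "h holomorphic_on ball 0 1" "norm z < 1"
  shows "(\<lambda>n. of_nat n * taylor_coeff h n * z ^ n) sums (z * deriv h z)"
proof -
  have "taylor_coeff (deriv h) n = of_nat (Suc n) * taylor_coeff h (Suc n)" for n
    by (simp add: taylor_coeff_def funpow_Suc_right divide_simps del: funpow.simps of_nat_Suc)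
  moreover have "(\<lambda>n. z * (taylor_coeff (deriv h) n * z ^ n)) sums (z * deriv h z)"
    using assms by (intro sums_mult taylor_coeff_sums holomorphic_deriv) auto
  ultimately have "(\<lambda>n. of_nat (Suc n) * taylor_coeff h (Suc n) * z ^ Suc n) sums (z * deriv h z)"
    by (simp add: mult_ac del: of_nat_Suc)
  from sums_Suc[OF this] show ?thesis by simp
qed

text \<open>For \<open>n \<ge> 1\<close> the coefficients of the two building blocks are
  \<open>\<mu> ^ (n - 1)\<close> and \<open>n * \<mu> ^ (n - 1)\<close>. Powers of
  \<open>\<mu>\<close> rotate the argument, and the factor \<open>n\<close> produces the Euler
  operator z d/dz.\<close>

lemma hadamard_halfplane_Koebe:
  fixes \<mu> \<alpha> \<beta> :: complex
  assumes \<mu>: "norm \<mu> = 1"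
    and k: "\<And>z. norm z < 1 \<Longrightarrow> k z = \<alpha> * (z / (1 - \<mu> * z)) + \<beta> * (z / (1 - \<mu> * z)\<^sup>2)"
    and h: "h holomorphic_on ball 0 1" "h 0 = 0" and z: "norm z < 1"
  shows "hadamard k h z = (\<alpha> * h (\<mu> * z) + \<beta> * (\<mu> * z * deriv h (\<mu> * z))) / \<mu>"
proof -
  have \<mu>0: "\<mu> \<noteq> 0" using \<mu> by auto
  \<comment> \<open>The quotient \<open>\<mu> ^ n / \<mu>\<close> stands for the exponent
    \<open>n - 1\<close>; at \<open>n = 0\<close> it would give \<open>\<alpha> / \<mu>\<close>
    where the true coefficient is 0.\<close>
  have k_coeff: "taylor_coeff k n = (if n = 0 then 0 else (\<alpha> + \<beta> * of_nat n) * \<mu> ^ n / \<mu>)" for n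
  proof (rule taylor_coeff_eqI)
    fix z :: complex assume z: "norm z < 1"
    then have \<mu>z: "norm (\<mu> * z) < 1" using \<mu> by (simp add: norm_mult)
    have "(\<lambda>n. \<alpha> * z * (\<mu> * z) ^ n + \<beta> * z * (of_nat (Suc n) * (\<mu> * z) ^ n)) sums
        (\<alpha> * z * (1 / (1 - \<mu> * z)) + \<beta> * z * (1 / (1 - \<mu> * z)\<^sup>2))"
      using \<mu>z by (intro sums_add sums_mult geometric_sums geometric_deriv_sums)
    moreover have "\<alpha> * z * (\<mu> * z) ^ n + \<beta> * z * (of_nat (Suc n) * (\<mu> * z) ^ n) =
        (if Suc n = 0 then 0 else (\<alpha> + \<beta> * of_nat (Suc n)) * \<mu> ^ Suc n / \<mu>) * z ^ Suc n" for n
      using \<mu>0 by (simp add: field_simps power_mult_distrib del: of_nat_Suc)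
    ultimately have "(\<lambda>n. (if Suc n = 0 then 0 else (\<alpha> + \<beta> * of_nat (Suc n)) * \<mu> ^ Suc n / \<mu>) * z ^ Suc n) sums k z"
      unfolding k[OF z] by (simp del: of_nat_Suc)
    from sums_Suc[OF this]
    show "(\<lambda>n. (if n = 0 then 0 else (\<alpha> + \<beta> * of_nat n) * \<mu> ^ n / \<mu>) * z ^ n) sums k z" by simp
  qed
  \<comment> \<open>The zeroth term of the series below is \<open>\<alpha> * h 0 / \<mu>\<close> and
    must match the zero coefficient of \<open>k\<close>.\<close>
  have h0: "taylor_coeff h 0 = 0" using h by (simp add: taylor_coeff_def)
  have \<mu>z: "norm (\<mu> * z) < 1" using \<mu> z by (simp add: norm_mult)
  have "(\<lambda>n. (\<alpha> * (taylor_coeff h n * (\<mu> * z) ^ n) + \<beta> * (of_nat n * taylor_coeff h n * (\<mu> * z) ^ n)) / \<mu>) sums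
      ((\<alpha> * h (\<mu> * z) + \<beta> * (\<mu> * z * deriv h (\<mu> * z))) / \<mu>)"
    using \<mu>z by (intro sums_divide sums_add sums_mult taylor_coeff_sums taylor_coeff_deriv_sums h)
  moreover have "(\<alpha> * (taylor_coeff h n * (\<mu> * z) ^ n) + \<beta> * (of_nat n * taylor_coeff h n * (\<mu> * z) ^ n)) / \<mu>
      = taylor_coeff k n * taylor_coeff h n * z ^ n" for n
    using \<mu>0 h0 by (simp add: k_coeff power_mult_distrib field_simps)
  ultimately show ?thesis unfolding hadamard_def by (simp add: sums_iff)
qed

section \<open>Explicit form of the half-plane map\<close>

text \<open>The shear gives the sum of \<open>h'\<close> and \<open>g' / \<mu>\<^sup>2\<close>, the
  dilatation their ratio, so both are determined. Their difference turns out to be the derivative of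
  a multiple of the rotated Koebe function; half the sum and half the difference of the two
  primitives give the formulas.\<close>

lemma halfplane_shear_explicit:
  fixes \<mu> :: complex and a :: real
  assumes \<mu>: "norm \<mu> = 1" and a: "-1 < a" "a < 1"
    and hol: "h holomorphic_on ball 0 1" "g holomorphic_on ball 0 1" "h 0 = 0" "g 0 = 0"
    and dh: "\<And>z. norm z < 1 \<Longrightarrow> deriv h z \<noteq> 0"
    and shear: "\<And>z. norm z < 1 \<Longrightarrow> h z + g z / \<mu>\<^sup>2 = (1 + of_real a) * z / (1 - \<mu> * z)"
    and dil: "\<And>z. norm z < 1 \<Longrightarrow> dilatation h g z = \<mu>\<^sup>2 * ((of_real a - \<mu> * z) / (1 - of_real a * (\<mu> * z)))"
    and z: "norm z < 1"
  shows "h z = (1 + of_real a) / 2 * (z / (1 - \<mu> * z)) + (1 - of_real a) / 2 * (z / (1 - \<mu> * z)\<^sup>2)"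
    and "g z = \<mu>\<^sup>2 * (1 + of_real a) / 2 * (z / (1 - \<mu> * z)) + - (\<mu>\<^sup>2 * (1 - of_real a) / 2) * (z / (1 - \<mu> * z)\<^sup>2)"
proof -
  have \<mu>0: "\<mu> \<noteq> 0" using \<mu> by auto
  \<comment> \<open>The expected value of the difference is subtracted; \<open>k\<close> is then
    constant and vanishes at the origin.\<close>
  define k where "k z = h z - g z / \<mu>\<^sup>2 - (1 - of_real a) * (z / (1 - \<mu> * z)\<^sup>2)" for z
  have "(k has_field_derivative 0) (at z)" if z: "z \<in> ball 0 1" for z
  proof -
    have z1: "norm z < 1" using z by simp
    define u where "u = \<mu> * z"
    have u: "norm u < 1" using z1 \<mu> by (simp add: u_def norm_mult)
    have nu: "1 - u \<noteq> 0" using u by auto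
    have "norm (of_real a * u) < 1" using a u by (simp add: norm_mult mult_le_one abs_less_iff order.strict_trans1[OF mult_right_le_one_le])
    then have nau: "1 - of_real a * u \<noteq> 0" by auto
    have na: "1 + complex_of_real a \<noteq> 0" using a by (simp add: complex_eq_iff)
    have h': "(h has_field_derivative deriv h z) (at z)" and g': "(g has_field_derivative deriv g z) (at z)"
      using hol z by (auto intro: holomorphic_derivI[OF _ open_ball])
    have "((\<lambda>z. h z + g z / \<mu>\<^sup>2) has_field_derivative (deriv h z + deriv g z / \<mu>\<^sup>2)) (at z)"
      by (intro DERIV_add DERIV_cdivide h' g')
    moreover have "((\<lambda>z. h z + g z / \<mu>\<^sup>2) has_field_derivative (1 + of_real a) / (1 - u)\<^sup>2) (at z)"
    proof (rule has_field_derivative_transform_within_open[OF _ open_ball z])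
      show "((\<lambda>z. (1 + of_real a) * z / (1 - \<mu> * z)) has_field_derivative (1 + of_real a) / (1 - u)\<^sup>2) (at z)"
        using nu unfolding u_def
        by (auto intro!: derivative_eq_intros simp: power2_eq_square divide_simps) (simp add: algebra_simps)
    qed (use shear in auto)
    ultimately have sum: "deriv h z + deriv g z / \<mu>\<^sup>2 = (1 + of_real a) / (1 - u)\<^sup>2" by (rule DERIV_unique)
    have g: "deriv g z / \<mu>\<^sup>2 = deriv h z * ((of_real a - u) / (1 - of_real a * u))"
    proof -
      have "deriv g z = deriv h z * dilatation h g z" using dh[OF z1] by (simp add: dilatation_def)
      then show ?thesis unfolding dil[OF z1] using \<mu>0 by (simp add: u_def)
    qed
    \<comment> \<open>Inserting the ratio into the sum leaves a factor \<open>1 - u\<close> beside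
      \<open>deriv h z\<close>, which raises the double pole at \<open>u = 1\<close> to a triple
      one.\<close>
    have "deriv h z * ((1 + of_real a) * (1 - u) / (1 - of_real a * u)) = (1 + of_real a) / (1 - u)\<^sup>2"
    proof -
      have "1 + (of_real a - u) / (1 - of_real a * u) = (1 + of_real a) * (1 - u) / (1 - of_real a * u)"
        using nau by (simp add: divide_simps) (simp add: algebra_simps)
      moreover have "deriv h z * (1 + (of_real a - u) / (1 - of_real a * u)) = (1 + of_real a) / (1 - u)\<^sup>2"
        using sum unfolding g by (simp only: distrib_left mult_1_right)
      ultimately show ?thesis by simp
    qed
    then have h: "deriv h z = (1 - of_real a * u) / (1 - u) ^ 3"
      using nau nu na by (simp add: divide_simps power2_eq_square power3_eq_cube mult.assoc)
    have "deriv h z - deriv g z / \<mu>\<^sup>2 = (1 - of_real a) * ((1 + u) / (1 - u) ^ 3)"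
      unfolding g unfolding h using nau nu by (simp add: divide_simps) (simp add: algebra_simps)
    moreover have "(k has_field_derivative (deriv h z - deriv g z / \<mu>\<^sup>2 - (1 - of_real a) * ((1 + u) / (1 - u) ^ 3))) (at z)"
    proof -
      have "((\<lambda>z. z / (1 - \<mu> * z)\<^sup>2) has_field_derivative (1 + u) / (1 - u) ^ 3) (at z)"
        using nu unfolding u_def
        by (auto intro!: derivative_eq_intros simp: power2_eq_square power3_eq_cube divide_simps) (simp add: algebra_simps)
      then show ?thesis unfolding k_def by (intro DERIV_diff DERIV_cdivide h' g' DERIV_cmult)
    qed
    ultimately show ?thesis by simp
  qed
  then obtain c where "\<And>z. z \<in> ball 0 1 \<Longrightarrow> k z = c"
    using has_field_derivative_zero_constant[of "ball 0 1" k] has_field_derivative_at_within by blast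
  then have "k z = k 0" using z by simp
  also have "k 0 = 0" by (simp add: k_def hol)
  finally have k: "h z - g z / \<mu>\<^sup>2 = (1 - of_real a) * (z / (1 - \<mu> * z)\<^sup>2)" by (simp add: k_def)
  have s: "h z + g z / \<mu>\<^sup>2 = (1 + of_real a) * (z / (1 - \<mu> * z))" using shear[OF z] by simp
  define A where "A = z / (1 - \<mu> * z)"
  define B where "B = z / (1 - \<mu> * z)\<^sup>2"
  have "h z = ((h z + g z / \<mu>\<^sup>2) + (h z - g z / \<mu>\<^sup>2)) / 2" by simp
  also have "\<dots> = (1 + of_real a) / 2 * A + (1 - of_real a) / 2 * B"
    unfolding k s A_def[symmetric] B_def[symmetric] by (simp add: field_simps)
  finally show "h z = (1 + of_real a) / 2 * (z / (1 - \<mu> * z)) + (1 - of_real a) / 2 * (z / (1 - \<mu> * z)\<^sup>2)"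
    unfolding A_def B_def .
  have "g z = \<mu>\<^sup>2 * ((h z + g z / \<mu>\<^sup>2) - (h z - g z / \<mu>\<^sup>2)) / 2" using \<mu>0 by simp
  also have "\<dots> = \<mu>\<^sup>2 * (1 + of_real a) / 2 * A + - (\<mu>\<^sup>2 * (1 - of_real a) / 2) * B"
    unfolding k s A_def[symmetric] B_def[symmetric] by (simp add: field_simps)
  finally show "g z = \<mu>\<^sup>2 * (1 + of_real a) / 2 * (z / (1 - \<mu> * z)) + - (\<mu>\<^sup>2 * (1 - of_real a) / 2) * (z / (1 - \<mu> * z)\<^sup>2)"
    unfolding A_def B_def .
qed

section \<open>Transport between the strip and the disk\<close>

text \<open>Up to the change of parameter \<open>\<sigma>\<close>, \<open>F\<close> is a rotation of
  \<open>F0\<close>; dividing a line of direction \<open>\<alpha>\<close> by the rotation factor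
  makes it horizontal.\<close>

lemma convex_in_direction_rotate:
  assumes \<sigma>: "\<sigma> ` \<Omega> = D" and F: "\<And>w. w \<in> \<Omega> \<Longrightarrow> F (\<sigma> w) = exp (\<i> * of_real \<alpha>) * F0 w"
  shows "inj_on F0 \<Omega> \<Longrightarrow> inj_on F D"
    and "convex_in_direction F0 \<Omega> 0 \<Longrightarrow> convex_in_direction F D \<alpha>"
proof -
  define c where "c = exp (\<i> * complex_of_real \<alpha>)"
  have c: "c \<noteq> 0" by (simp add: c_def)
  show "inj_on F D" if "inj_on F0 \<Omega>"
    unfolding \<sigma>[symmetric] using that F by (fastforce simp: inj_on_def)
  assume conv: "convex_in_direction F0 \<Omega> 0"
  have "F ` D = (\<lambda>w. c * F0 w) ` \<Omega>"
    unfolding \<sigma>[symmetric] image_image c_def using F by auto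
  then have "w + of_real t * c \<in> F ` D \<longleftrightarrow> w / c + of_real t \<in> F0 ` \<Omega>" for w t
    using c by (auto simp: image_iff field_simps)
  then show "convex_in_direction F D \<alpha>"
    using conv unfolding convex_in_direction_def c_def by simp
qed

text \<open>\<open>\<psi>\<close> inverts the shear, and \<open>W = \<psi> / \<psi>'\<close> turns
  the Euler operator z d/dz into \<open>W\<close> times d/dw. The unimodular \<open>l\<close> is a
  rotation: the pair \<open>(l * h, g / l)\<close> represents \<open>l\<close> times the harmonic
  map, because \<open>cnj (1 / l) = l\<close>.\<close>

lemma convolution_in_strip_coordinate:
  fixes h g h1 g1 \<psi> \<psi>' W W' :: "complex \<Rightarrow> complex" and \<mu> l \<epsilon> :: complex and X :: "real set"
    and a \<alpha> :: real and n :: nat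
  assumes X: "open X" "is_interval X"
    and \<psi>_surj: "\<psi> ` {w. Re w \<in> X} = ball 0 1"
    and \<psi>': "\<And>w. Re w \<in> X \<Longrightarrow> (\<psi> has_field_derivative \<psi>' w) (at w)"
    and W\<psi>: "\<And>w. Re w \<in> X \<Longrightarrow> W w * \<psi>' w = \<psi> w"
    and W: "\<And>w. Re w \<in> X \<Longrightarrow> (W has_field_derivative W' w) (at w)"
    and W': "\<And>w. Re w \<in> X \<Longrightarrow> Re (W' w) > 0"
    and top: "\<And>x. x \<in> X \<Longrightarrow> filterlim (\<lambda>y. Im (W (Complex x y))) at_top at_top"
    and bot: "\<And>x. x \<in> X \<Longrightarrow> filterlim (\<lambda>y. Im (W (Complex x y))) at_bot at_bot"
    and SH: "in_SH h g"
    and l: "norm l = 1" and shear: "\<And>w. Re w \<in> X \<Longrightarrow> l * h (\<psi> w) + g (\<psi> w) / l = w"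
    and \<epsilon>: "norm \<epsilon> = 1" and n: "n \<ge> 1"
    and dil: "\<And>z. norm z < 1 \<Longrightarrow> dilatation h g z = \<epsilon> * z ^ n"
    and \<mu>: "norm \<mu> = 1" and a: "a < 1" "2 * real n / (real n + 2) \<le> 1 + a"
    and h1: "\<And>z. norm z < 1 \<Longrightarrow>
      h1 z = (1 + of_real a) / 2 * (z / (1 - \<mu> * z)) + (1 - of_real a) / 2 * (z / (1 - \<mu> * z)\<^sup>2)"
    and g1: "\<And>z. norm z < 1 \<Longrightarrow>
      g1 z = \<mu>\<^sup>2 * (1 + of_real a) / 2 * (z / (1 - \<mu> * z)) + - (\<mu>\<^sup>2 * (1 - of_real a) / 2) * (z / (1 - \<mu> * z)\<^sup>2)"
    and \<alpha>: "exp (\<i> * of_real \<alpha>) = 1 / (\<mu> * l)"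
  shows "inj_on (harm_conv h1 g1 h g) (ball 0 1) \<and> convex_in_direction (harm_conv h1 g1 h g) (ball 0 1) \<alpha>"
proof -
  define b where "b = 1 - a"
  \<comment> \<open>This is the dilatation of the rotated pair \<open>H\<close>, \<open>G\<close>;
    the square comes from dividing \<open>g / l\<close> by \<open>l * h\<close>.\<close>
  define \<Theta> where "\<Theta> w = \<epsilon> * \<psi> w ^ n / l\<^sup>2" for w
  define \<Theta>' where "\<Theta>' w = \<epsilon> * (of_nat n * \<psi> w ^ (n - 1) * \<psi>' w) / l\<^sup>2" for w
  define H where "H w = l * h (\<psi> w)" for w
  define G where "G w = g (\<psi> w) / l" for w
  have \<mu>0: "\<mu> \<noteq> 0" and l0: "l \<noteq> 0" using \<mu> l by auto
  have hol: "h holomorphic_on ball 0 1" "g holomorphic_on ball 0 1" and h0: "h 0 = 0" "g 0 = 0"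
    using SH by (auto simp: in_SH_def)
  have dh: "deriv h z \<noteq> 0" if "norm z < 1" for z
    using SH that norm_ge_zero[of "deriv g z"] by (force simp: in_SH_def)
  \<comment> \<open>With \<open>1 + a = 2 - b\<close> the range condition on \<open>a\<close>
    becomes \<open>b \<le> 4 / (n + 2)\<close>.\<close>
  have b: "0 < b" "b * (n + 2) \<le> 4"
    using a by (simp_all add: b_def field_simps)
  have \<psi>1: "norm (\<psi> w) < 1" if "Re w \<in> X" for w
    using \<psi>_surj that by (auto simp: set_eq_iff image_iff)
  have op: "open {w. Re w \<in> X}"
    using open_vimage[OF X(1), of Re] by (simp add: vimage_def continuous_intros)
  have \<Theta>1: "norm (\<Theta> w) < 1" if w: "Re w \<in> X" for w
    using \<psi>1[OF w] l \<epsilon> n by (simp add: \<Theta>_def norm_mult norm_divide norm_power power_less_one_iff)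
  have \<Theta>D: "(\<Theta> has_field_derivative \<Theta>' w) (at w)" if w: "Re w \<in> X" for w
    unfolding \<Theta>_def \<Theta>'_def using DERIV_power[OF \<psi>'[OF w], of n]
    by (intro DERIV_cdivide DERIV_cmult) (simp add: mult_ac)
  have WT: "W w * \<Theta>' w = of_nat n * \<Theta> w" if w: "Re w \<in> X" for w
  proof -
    have "W w * \<Theta>' w = \<epsilon> * (of_nat n * \<psi> w ^ (n - 1) * (W w * \<psi>' w)) / l\<^sup>2"
      by (simp add: \<Theta>'_def)
    also have "\<psi> w ^ n = \<psi> w ^ (n - 1) * \<psi> w" using n by (cases n) auto
    then have "\<epsilon> * (of_nat n * \<psi> w ^ (n - 1) * (W w * \<psi>' w)) / l\<^sup>2 = of_nat n * \<Theta> w"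
      unfolding W\<psi>[OF w] by (simp add: \<Theta>_def)
    finally show ?thesis .
  qed
  have H'0: "(H has_field_derivative l * (deriv h (\<psi> w) * \<psi>' w)) (at w)" if w: "Re w \<in> X" for w
    unfolding H_def using \<psi>1[OF w]
    by (intro DERIV_cmult DERIV_chain2[OF _ \<psi>'[OF w]] holomorphic_derivI[OF hol(1)]) auto
  have G'0: "(G has_field_derivative (deriv g (\<psi> w) * \<psi>' w) / l) (at w)" if w: "Re w \<in> X" for w
    unfolding G_def using \<psi>1[OF w]
    by (intro DERIV_cdivide DERIV_chain2[OF _ \<psi>'[OF w]] holomorphic_derivI[OF hol(2)]) auto
  have H'eq: "l * (deriv h (\<psi> w) * \<psi>' w) = 1 / (1 + \<Theta> w)"
    and G'eq: "deriv g (\<psi> w) * \<psi>' w / l = \<Theta> w / (1 + \<Theta> w)" if w: "Re w \<in> X" for w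
  proof -
    have nz: "1 + \<Theta> w \<noteq> 0" using \<Theta>1[OF w] by (metis add_eq_0_iff norm_minus_cancel norm_one less_irrefl)
    \<comment> \<open>In the coordinate \<open>w\<close> the shear is the identity, so the
      derivatives of \<open>H\<close> and \<open>G\<close> add up to 1; their ratio is
      \<open>\<Theta>\<close>.\<close>
    have "((\<lambda>w. H w + G w) has_field_derivative 1) (at w)"
      by (rule has_field_derivative_transform_within_open[OF DERIV_ident op])
         (use w shear in \<open>auto simp: H_def G_def\<close>)
    from DERIV_unique[OF DERIV_add[OF H'0[OF w] G'0[OF w]] this]
    have sum: "l * (deriv h (\<psi> w) * \<psi>' w) + deriv g (\<psi> w) * \<psi>' w / l = 1" .
    have "deriv g (\<psi> w) = deriv h (\<psi> w) * dilatation h g (\<psi> w)"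
      using dh[OF \<psi>1[OF w]] by (simp add: dilatation_def)
    then have g: "deriv g (\<psi> w) * \<psi>' w / l = \<Theta> w * (l * (deriv h (\<psi> w) * \<psi>' w))"
      using l0 by (simp add: dil[OF \<psi>1[OF w]] \<Theta>_def field_simps power2_eq_square)
    have "l * (deriv h (\<psi> w) * \<psi>' w) * (1 + \<Theta> w) = 1"
      using sum unfolding g by (simp add: algebra_simps)
    then show 1: "l * (deriv h (\<psi> w) * \<psi>' w) = 1 / (1 + \<Theta> w)"
      using nz by (simp add: eq_divide_eq)
    show "deriv g (\<psi> w) * \<psi>' w / l = \<Theta> w / (1 + \<Theta> w)" unfolding g 1 by simp
  qed
  define p where "p w = ((2 - b) * H w + b * (W w / (1 + \<Theta> w))) / 2" for w
  define q where "q w = ((2 - b) * G w - b * (W w * \<Theta> w / (1 + \<Theta> w))) / 2" for w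
  have inj: "inj_on (harm p q) {w. Re w \<in> X}" and conv: "convex_in_direction (harm p q) {w. Re w \<in> X} 0"
    unfolding p_def[abs_def] q_def[abs_def]
    by (rule convolution_on_strip[OF X b _ _ W \<Theta>D \<Theta>1 WT W' top bot]; use H'0 G'0 H'eq G'eq in simp)+
  \<comment> \<open>Evaluating at \<open>\<psi> w / \<mu>\<close> cancels the rotation of the
    argument in \<open>hadamard_halfplane_Koebe\<close>.\<close>
  have \<sigma>: "(\<lambda>w. \<psi> w / \<mu>) ` {w. Re w \<in> X} = ball 0 1"
  proof -
    have "(\<lambda>w. \<psi> w / \<mu>) ` {w. Re w \<in> X} = (\<lambda>z. z / \<mu>) ` ball 0 1"
      unfolding \<psi>_surj[symmetric] image_image ..
    also have "\<dots> = ball 0 1"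
    proof (intro equalityI subsetI)
      fix z :: complex assume "z \<in> ball 0 1"
      then show "z \<in> (\<lambda>z. z / \<mu>) ` ball 0 1"
        using \<mu> \<mu>0 by (intro image_eqI[of _ _ "z * \<mu>"]) (auto simp: norm_mult)
    qed (use \<mu> in \<open>auto simp: norm_divide\<close>)
    finally show ?thesis .
  qed
  \<comment> \<open>The two Hadamard products come out as \<open>p w / (\<mu> * l)\<close> and
    \<open>q w * (\<mu> * l)\<close>; conjugating the second inverts its unimodular factor, so both
    parts carry the same rotation.\<close>
  have conj: "cnj \<mu> = 1 / \<mu>" "cnj l = 1 / l"
    using \<mu> l \<mu>0 l0 complex_norm_square[of \<mu>] complex_norm_square[of l] by (simp_all add: field_simps)
  have F: "harm_conv h1 g1 h g (\<psi> w / \<mu>) = exp (\<i> * of_real \<alpha>) * harm p q w" if "w \<in> {w. Re w \<in> X}" for w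
  proof -
    have w: "Re w \<in> X" using that by simp
    have z: "norm (\<psi> w / \<mu>) < 1" using \<psi>1[OF w] \<mu> by (simp add: norm_divide)
    have Hd: "l * (\<psi> w * deriv h (\<psi> w)) = W w / (1 + \<Theta> w)"
    proof -
      have "l * (\<psi> w * deriv h (\<psi> w)) = l * ((W w * \<psi>' w) * deriv h (\<psi> w))"
        unfolding W\<psi>[OF w] ..
      also have "\<dots> = W w * (l * (deriv h (\<psi> w) * \<psi>' w))" by (simp add: mult_ac)
      also have "\<dots> = W w / (1 + \<Theta> w)" unfolding H'eq[OF w] by simp
      finally show ?thesis .
    qed
    have Gd: "\<psi> w * deriv g (\<psi> w) / l = W w * \<Theta> w / (1 + \<Theta> w)"
    proof -
      have "\<psi> w * deriv g (\<psi> w) / l = (W w * \<psi>' w) * deriv g (\<psi> w) / l"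
        unfolding W\<psi>[OF w] ..
      also have "\<dots> = W w * (deriv g (\<psi> w) * \<psi>' w / l)" by (simp add: mult_ac)
      also have "\<dots> = W w * \<Theta> w / (1 + \<Theta> w)" unfolding G'eq[OF w] by simp
      finally show ?thesis .
    qed
    have "hadamard h1 h (\<psi> w / \<mu>) = ((1 + of_real a) / 2 * h (\<psi> w) + (1 - of_real a) / 2 * (\<psi> w * deriv h (\<psi> w))) / \<mu>"
      using hadamard_halfplane_Koebe[OF \<mu> h1 hol(1) h0(1) z] \<mu>0 by simp
    also have "\<dots> = p w / (\<mu> * l)"
      unfolding p_def Hd[symmetric] using \<mu>0 l0 by (simp add: H_def b_def field_simps)
    finally have P: "hadamard h1 h (\<psi> w / \<mu>) = p w / (\<mu> * l)" .
    have "hadamard g1 g (\<psi> w / \<mu>) = (\<mu>\<^sup>2 * (1 + of_real a) / 2 * g (\<psi> w) + - (\<mu>\<^sup>2 * (1 - of_real a) / 2) * (\<psi> w * deriv g (\<psi> w))) / \<mu>"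
      using hadamard_halfplane_Koebe[OF \<mu> g1 hol(2) h0(2) z] \<mu>0 by simp
    also have "\<dots> = q w * (\<mu> * l)"
      unfolding q_def Gd[symmetric] using \<mu>0 l0 by (simp add: G_def b_def field_simps power2_eq_square)
    finally have Q: "hadamard g1 g (\<psi> w / \<mu>) = q w * (\<mu> * l)" .
    show ?thesis
      unfolding \<alpha> harm_conv_def harm_def P Q using conj by (simp add: add_divide_distrib)
  qed
  show ?thesis
    using convex_in_direction_rotate[of _ _ _ "harm_conv h1 g1 h g" _ "harm p q", OF \<sigma> F] inj conv by blast
qed

section \<open>Growth on vertical lines and inverses of the two shears\<close>

lemma filterlim_linear_at_infinity:
  fixes c :: real assumes "c > 0"
  shows "filterlim (\<lambda>y. y * c) at_top at_top" "filterlim (\<lambda>y. y * c) at_bot at_bot"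
  using assms by real_asymp+

lemma filterlim_exp_diff_at_infinity:
  fixes c k :: real assumes "c > 0" "k > 0"
  shows "filterlim (\<lambda>y. c * (exp (k * y) - exp (- (k * y)))) at_top at_top"
    "filterlim (\<lambda>y. c * (exp (k * y) - exp (- (k * y)))) at_bot at_bot"
  using assms by real_asymp+

text \<open>The boundary line is the perpendicular bisector of 0 and -1.\<close>

lemma norm_halfplane: "- (1/2) < Re w \<longleftrightarrow> norm w < norm (1 + w)"
proof -
  have "norm w < norm (1 + w) \<longleftrightarrow> (norm w)\<^sup>2 < (norm (1 + w))\<^sup>2"
    by (metis norm_ge_zero power2_less_imp_less power_strict_mono pos2)
  then show ?thesis unfolding cmod_power2 by (auto simp: power2_eq_square algebra_simps)
qed

text \<open>The map inverts \<open>l * z / (1 - l * z)\<close>, which is \<open>l\<close> times the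
  shear of the half-plane map.\<close>

lemma halfplane_uniformization:
  assumes l: "norm l = 1"
  shows "(\<lambda>w. w / (1 + w) / l) ` {w. - (1/2) < Re w} = ball 0 1"
proof (intro equalityI subsetI)
  fix z assume "z \<in> (\<lambda>w. w / (1 + w) / l) ` {w. - (1/2) < Re w}"
  then obtain w where w: "- (1/2) < Re w" "z = w / (1 + w) / l" by auto
  then have "norm w < norm (1 + w)" by (simp add: norm_halfplane)
  moreover from this have "0 < norm (1 + w)" by (rule order.strict_trans1[OF norm_ge_zero])
  ultimately show "z \<in> ball 0 1" using l w(2) by (simp add: norm_divide norm_mult)
next
  fix z :: complex assume z: "z \<in> ball 0 1"
  define w where "w = l * z / (1 - l * z)"
  have "norm (l * z) < 1" using z l by (simp add: norm_mult)
  then have nz: "1 - l * z \<noteq> 0" and "l \<noteq> 0" using l by auto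
  have 1: "1 + w = 1 / (1 - l * z)" using nz by (simp add: w_def field_simps)
  have "norm w < norm (1 + w)"
    unfolding 1 unfolding w_def using z l nz by (simp add: norm_mult norm_divide divide_strict_right_mono)
  then have "- (1/2) < Re w" by (simp add: norm_halfplane)
  moreover have "z = w / (1 + w) / l" unfolding 1 using nz \<open>l \<noteq> 0\<close> by (simp add: w_def)
  ultimately show "z \<in> (\<lambda>w. w / (1 + w) / l) ` {w. - (1/2) < Re w}" by auto
qed

text \<open>The exponential opens the strip to the half-plane of arguments between
  \<open>\<beta> - pi\<close> and \<open>\<beta>\<close>, and \<open>(u - 1) / (E - u / E)\<close>
  is the solution z of \<open>(1 + z * E) / (1 + z / E) = u\<close>. Together they invert the
  logarithmic shear.\<close>

lemma strip_uniformization: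
  fixes \<beta> :: real and w :: complex
  assumes \<beta>: "0 < \<beta>" "\<beta> < pi"
    and w: "(\<beta> - pi) / (2 * sin \<beta>) < Re w" "Re w < \<beta> / (2 * sin \<beta>)"
  defines "E \<equiv> exp (\<i> * of_real \<beta>)" and "u \<equiv> exp (2 * \<i> * of_real (sin \<beta>) * w)"
  shows "norm ((u - 1) / (E - u / E)) < 1" "E - u / E \<noteq> 0"
    and "(1 + (u - 1) / (E - u / E) * E) / (1 + (u - 1) / (E - u / E) / E) = u"
    and "Ln u = 2 * \<i> * of_real (sin \<beta>) * w"
proof -
  have s: "sin \<beta> > 0" using \<beta> by (simp add: sin_gt_zero)
  \<comment> \<open>\<open>r\<close> and \<open>\<eta>\<close> are modulus and argument of
    \<open>u\<close>; the strip keeps \<open>\<eta>\<close> within the principal range.\<close>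
  define \<eta> where "\<eta> = 2 * sin \<beta> * Re w"
  define r where "r = exp (- (2 * sin \<beta> * Im w))"
  have \<eta>: "\<beta> - pi < \<eta>" "\<eta> < \<beta>" using w s by (simp_all add: \<eta>_def field_simps)
  have r: "r > 0" by (simp add: r_def)
  show "Ln u = 2 * \<i> * of_real (sin \<beta>) * w"
    unfolding u_def using \<eta> \<beta> by (intro Ln_exp) (auto simp: \<eta>_def)
  have u: "Re u = r * cos \<eta>" "Im u = r * sin \<eta>"
    by (simp_all add: u_def r_def \<eta>_def Re_exp Im_exp)
  have E: "E = Complex (cos \<beta>) (sin \<beta>)" by (simp add: E_def complex_eq_iff Re_exp Im_exp)
  have E0: "E \<noteq> 0" by (simp add: E_def)
  have iE: "1 / E = Complex (cos \<beta>) (- sin \<beta>)"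
    by (simp add: E_def exp_minus[symmetric] divide_inverse complex_eq_iff Re_exp Im_exp)
  have nE: "norm E = 1" by (simp add: E_def)
  \<comment> \<open>\<open>E * E\<close> is the mirror image of 1 in the line through 0 and
    \<open>E\<close>, which bounds the half-plane; points on the side of 1 are closer to 1.\<close>
  have "(norm (u - 1))\<^sup>2 < (norm (u - E * E))\<^sup>2"
  proof -
    have "sin (\<beta> - \<eta>) > 0" using \<eta> by (intro sin_gt_zero) auto
    then have pos: "0 < 4 * r * sin \<beta> * sin (\<beta> - \<eta>)" using r s by simp
    have polar: "(norm (u - Complex (cos \<phi>) (sin \<phi>)))\<^sup>2 = r\<^sup>2 + 1 - 2 * r * cos (\<eta> - \<phi>)" for \<phi>
    proof -
      have "(norm (u - Complex (cos \<phi>) (sin \<phi>)))\<^sup>2 =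
          r\<^sup>2 * ((cos \<eta>)\<^sup>2 + (sin \<eta>)\<^sup>2) + ((cos \<phi>)\<^sup>2 + (sin \<phi>)\<^sup>2) - 2 * r * cos (\<eta> - \<phi>)"
        unfolding cmod_power2 cos_diff by (simp add: u power2_eq_square algebra_simps del: sin_cos_squared_add3)
      then show ?thesis by simp
    qed
    have "E * E = Complex (cos (2 * \<beta>)) (sin (2 * \<beta>))"
      by (simp add: E cos_double sin_double power2_eq_square complex_eq_iff)
    moreover have "cos \<eta> - cos (\<eta> - 2 * \<beta>) = 2 * sin \<beta> * sin (\<beta> - \<eta>)"
      using cos_diff_cos[of \<eta> "\<eta> - 2 * \<beta>"] sin_minus[of "\<beta> - \<eta>"] by (simp add: diff_divide_distrib add_divide_distrib)
    ultimately have "(norm (u - E * E))\<^sup>2 - (norm (u - 1))\<^sup>2 = 4 * r * sin \<beta> * sin (\<beta> - \<eta>)"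
      using polar[of "2 * \<beta>"] polar[of 0] by (simp add: algebra_simps flip: one_complex.code)
    with pos show ?thesis by simp
  qed
  then have "norm (u - 1) < norm (u - E * E)" by (rule power2_less_imp_less) simp
  also have "u - E * E = - E * (E - u / E)" using E0 by (simp add: algebra_simps)
  also have "norm (- E * (E - u / E)) = norm (E - u / E)" by (simp only: norm_mult norm_minus_cancel nE mult_1_left)
  finally have lt: "norm (u - 1) < norm (E - u / E)" .
  then show D: "E - u / E \<noteq> 0" by auto
  show "norm ((u - 1) / (E - u / E)) < 1" using lt by (simp add: norm_divide divide_less_eq)
  \<comment> \<open>This is \<open>2 * \<i> * sin \<beta>\<close>, the common factor that cancels in
    the final quotient.\<close>
  have "E - 1 / E \<noteq> 0" using s iE by (simp add: E complex_eq_iff)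
  have "1 + (u - 1) / (E - u / E) * E = u * (E - 1 / E) / (E - u / E)"
    using D E0 by (simp add: add_divide_eq_iff) (simp add: field_simps)
  moreover have "1 + (u - 1) / (E - u / E) / E = (E - 1 / E) / (E - u / E)"
    using D E0 by (simp add: add_divide_eq_iff) (simp add: field_simps)
  ultimately show "(1 + (u - 1) / (E - u / E) * E) / (1 + (u - 1) / (E - u / E) / E) = u"
    using D \<open>E - 1 / E \<noteq> 0\<close> by simp
qed

section \<open>The two target domains: half-plane and strip\<close>

text \<open>For \<open>\<psi> w = w / (1 + w) / l\<close> the quotient
  \<open>\<psi> / \<psi>'\<close> is \<open>w * (1 + w)\<close>. Its derivative
  \<open>1 + 2 * w\<close> has positive real part exactly where \<open>Re w > - 1/2\<close>.\<close>

lemma convolution_halfplane: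
  fixes h g h1 g1 :: "complex \<Rightarrow> complex" and \<mu> l \<epsilon> :: complex and a \<alpha> :: real and n :: nat
  assumes SH: "in_SH h g" and l: "norm l = 1"
    and shear: "\<And>z. norm z < 1 \<Longrightarrow> h z + g z / l\<^sup>2 = z / (1 - l * z)"
    and \<epsilon>: "norm \<epsilon> = 1" and n: "n \<ge> 1"
    and dil: "\<And>z. norm z < 1 \<Longrightarrow> dilatation h g z = \<epsilon> * z ^ n"
    and \<mu>: "norm \<mu> = 1" and a: "a < 1" "2 * real n / (real n + 2) \<le> 1 + a"
    and h1: "\<And>z. norm z < 1 \<Longrightarrow>
      h1 z = (1 + of_real a) / 2 * (z / (1 - \<mu> * z)) + (1 - of_real a) / 2 * (z / (1 - \<mu> * z)\<^sup>2)"
    and g1: "\<And>z. norm z < 1 \<Longrightarrow>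
      g1 z = \<mu>\<^sup>2 * (1 + of_real a) / 2 * (z / (1 - \<mu> * z)) + - (\<mu>\<^sup>2 * (1 - of_real a) / 2) * (z / (1 - \<mu> * z)\<^sup>2)"
    and \<alpha>: "exp (\<i> * of_real \<alpha>) = 1 / (\<mu> * l)"
  shows "inj_on (harm_conv h1 g1 h g) (ball 0 1) \<and> convex_in_direction (harm_conv h1 g1 h g) (ball 0 1) \<alpha>"
proof -
  define X :: "real set" where "X = {- (1/2)<..}"
  define \<psi> where "\<psi> w = w / (1 + w) / l" for w
  have l0: "l \<noteq> 0" using l by auto
  have nz: "1 + w \<noteq> 0" if "Re w \<in> X" for w using that by (auto simp: X_def complex_eq_iff)
  have surj: "\<psi> ` {w. Re w \<in> X} = ball 0 1"
    using halfplane_uniformization[OF l] by (simp add: \<psi>_def[abs_def] X_def)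
  have D: "(\<psi> has_field_derivative 1 / (1 + w)\<^sup>2 / l) (at w)" if w: "Re w \<in> X" for w
    unfolding \<psi>_def using nz[OF w]
    by (intro DERIV_cdivide) (auto intro!: derivative_eq_intros simp: power2_eq_square)
  have W\<psi>: "(w * (1 + w)) * (1 / (1 + w)\<^sup>2 / l) = \<psi> w" if w: "Re w \<in> X" for w
    using nz[OF w] by (simp add: \<psi>_def power2_eq_square)
  have W: "((\<lambda>w. w * (1 + w)) has_field_derivative 1 + 2 * w) (at w)" for w :: complex
    by (auto intro!: derivative_eq_intros)
  have sh: "l * h (\<psi> w) + g (\<psi> w) / l = w" if w: "Re w \<in> X" for w
  proof -
    have "norm (\<psi> w) < 1" using surj w by (auto simp: set_eq_iff image_iff)
    then have "h (\<psi> w) + g (\<psi> w) / l\<^sup>2 = \<psi> w / (1 - l * \<psi> w)" by (rule shear)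
    moreover have "l * \<psi> w = w / (1 + w)" using l0 by (simp add: \<psi>_def)
    then have "1 - l * \<psi> w = 1 / (1 + w)" using nz[OF w] by (simp add: field_simps)
    ultimately have "h (\<psi> w) + g (\<psi> w) / l\<^sup>2 = w / l" using nz[OF w] by (simp add: \<psi>_def)
    moreover have "l * h (\<psi> w) + g (\<psi> w) / l = l * (h (\<psi> w) + g (\<psi> w) / l\<^sup>2)"
      using l0 by (simp add: distrib_left power2_eq_square)
    ultimately show ?thesis using l0 by simp
  qed
  \<comment> \<open>Linear in \<open>y\<close>, with slope \<open>1 + 2 * x\<close> positive on
    \<open>X\<close>.\<close>
  have Im: "Im (Complex x y * (1 + Complex x y)) = y * (1 + 2 * x)" for x y
    by (simp add: algebra_simps)
  show ?thesis
  proof (rule convolution_in_strip_coordinate[where X=X and \<psi>=\<psi> and W="\<lambda>w. w * (1 + w)" and a=a,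
      OF _ _ surj D W\<psi> W _ _ _ SH l sh \<epsilon> n dil \<mu> a h1 g1 \<alpha>])
    show "open X" "is_interval X" by (auto simp: X_def is_interval_1)
    show "LIM y at_top. Im (Complex x y * (1 + Complex x y)) :> at_top"
      "LIM y at_bot. Im (Complex x y * (1 + Complex x y)) :> at_bot" if "x \<in> X" for x
      unfolding Im using that by (intro filterlim_linear_at_infinity; simp add: X_def)+
  qed (auto simp: X_def)
qed

text \<open>Here \<open>\<psi> / \<psi>'\<close> is an affine function of a cosine, and the sign of
  one sine on the strip decides both the positivity of \<open>Re W'\<close> and the growth of
  \<open>Im W\<close>.\<close>

lemma convolution_strip:
  fixes h g h1 g1 :: "complex \<Rightarrow> complex" and \<mu> \<epsilon> :: complex and a \<alpha> \<beta> :: real and n :: nat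
  assumes SH: "in_SH h g" and \<beta>: "0 < \<beta>" "\<beta> < pi" and img: "harm h g ` ball 0 1 = strip_Omega \<beta>"
    and shear: "\<And>z. norm z < 1 \<Longrightarrow> h z + g z
                = 1 / (2 * \<i> * of_real (sin \<beta>)) *
                  Ln ((1 + z * exp (\<i> * of_real \<beta>)) / (1 + z * exp (- \<i> * of_real \<beta>)))"
    and \<epsilon>: "norm \<epsilon> = 1" and n: "n \<ge> 1"
    and dil: "\<And>z. norm z < 1 \<Longrightarrow> dilatation h g z = \<epsilon> * z ^ n"
    and \<mu>: "norm \<mu> = 1" and a: "a < 1" "2 * real n / (real n + 2) \<le> 1 + a"
    and h1: "\<And>z. norm z < 1 \<Longrightarrow>
      h1 z = (1 + of_real a) / 2 * (z / (1 - \<mu> * z)) + (1 - of_real a) / 2 * (z / (1 - \<mu> * z)\<^sup>2)"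
    and g1: "\<And>z. norm z < 1 \<Longrightarrow>
      g1 z = \<mu>\<^sup>2 * (1 + of_real a) / 2 * (z / (1 - \<mu> * z)) + - (\<mu>\<^sup>2 * (1 - of_real a) / 2) * (z / (1 - \<mu> * z)\<^sup>2)"
    and \<alpha>: "exp (\<i> * of_real \<alpha>) = 1 / \<mu>"
  shows "inj_on (harm_conv h1 g1 h g) (ball 0 1) \<and> convex_in_direction (harm_conv h1 g1 h g) (ball 0 1) \<alpha>"
proof -
  define s where "s = sin \<beta>"
  define X where "X = {(\<beta> - pi) / (2 * s) <..< \<beta> / (2 * s)}"
  define E where "E = exp (\<i> * complex_of_real \<beta>)"
  define u where "u w = exp (2 * \<i> * of_real s * w)" for w
  define \<psi> where "\<psi> w = (u w - 1) / (E - u w / E)" for w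
  define \<psi>' where "\<psi>' w = - 4 * (of_real s)\<^sup>2 * u w / (E - u w / E)\<^sup>2" for w
  \<comment> \<open>Closed form of \<open>\<psi> / \<psi>' = - (u - 1) * (E - u / E) / (4 *
    s\<^sup>2 * u)\<close>, where \<open>u / E\<close> is the exponential of
    \<open>\<i> * (2 * s * w - \<beta>)\<close>.\<close>
  define W where "W w = (cos (2 * of_real s * w - of_real \<beta>) - of_real (cos \<beta>)) / (2 * (of_real s)\<^sup>2)" for w :: complex
  define W' where "W' w = - sin (2 * of_real s * w - of_real \<beta>) / of_real s" for w :: complex
  have s: "s > 0" using \<beta> by (simp add: s_def sin_gt_zero)
  have E0: "E \<noteq> 0" by (simp add: E_def)
  have iE: "exp (- \<i> * complex_of_real \<beta>) = 1 / E" by (simp add: E_def exp_minus divide_inverse)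
  have E: "E = Complex (cos \<beta>) (sin \<beta>)" and E': "1 / E = Complex (cos \<beta>) (- sin \<beta>)"
    unfolding iE[symmetric] by (simp_all add: E_def complex_eq_iff Re_exp Im_exp)
  have Es: "E - 1 / E = 2 * \<i> * of_real s" and Ec: "E + 1 / E = 2 * of_real (cos \<beta>)"
    unfolding E' unfolding E s_def by (simp_all add: complex_eq_iff)
  have strip: "norm (\<psi> w) < 1" "E - u w / E \<noteq> 0" "(1 + \<psi> w * E) / (1 + \<psi> w / E) = u w" "Ln (u w) = 2 * \<i> * of_real s * w"
    if w: "Re w \<in> X" for w
    using strip_uniformization[OF \<beta>, of w] w
    unfolding \<psi>_def u_def E_def s_def X_def by simp_all
  have sh: "h (\<psi> w) + g (\<psi> w) = w" if w: "Re w \<in> X" for w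
    using shear[OF strip(1)[OF w]] strip(3)[OF w] s unfolding iE E_def[symmetric] s_def[symmetric]
    by (simp add: strip(4)[OF w])
  have surj: "\<psi> ` {w. Re w \<in> X} = ball 0 1"
  proof (intro equalityI subsetI)
    fix z assume "z \<in> \<psi> ` {w. Re w \<in> X}"
    then show "z \<in> ball 0 1" using strip(1) by auto
  next
    fix z :: complex assume z: "z \<in> ball 0 1"
    \<comment> \<open>The preimage of \<open>z\<close> is the value of the shear there; it has the
      same real part as the harmonic map, so \<open>img\<close> places it in the strip.\<close>
    define w where "w = h z + g z"
    define v where "v = (1 + z * E) / (1 + z / E)"
    have nE: "norm E = 1" by (simp add: E_def)
    have "norm (z * E) < 1" "norm (z / E) < 1" using z nE by (simp_all add: norm_mult norm_divide)
    then have nz: "1 + z * E \<noteq> 0" "1 + z / E \<noteq> 0"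
      by (metis add_eq_0_iff norm_minus_cancel norm_one less_irrefl)+
    have "harm h g z \<in> strip_Omega \<beta>" using z img by blast
    moreover have "Re (harm h g z) = Re w" by (simp add: harm_def w_def)
    ultimately have w: "Re w \<in> X" by (simp add: strip_Omega_def X_def s_def)
    have "w = 1 / (2 * \<i> * of_real s) * Ln v"
      using shear[of z] z unfolding iE E_def[symmetric] s_def[symmetric] by (simp add: w_def v_def)
    \<comment> \<open>Exponentiating this removes the logarithm without any question of
      branches.\<close>
    then have "2 * \<i> * of_real s * w = Ln v" using s by simp
    then have u: "u w = v" unfolding u_def using nz by (simp add: v_def)
    have "v - 1 = z * (E - 1 / E) / (1 + z / E)"
      unfolding v_def using nz E0 by (simp add: divide_simps) (simp add: algebra_simps)
    moreover have "E - v / E = (E - 1 / E) / (1 + z / E)"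
    proof -
      have "E - v / E = (E * (1 + z / E) - (1 + z * E) / E) / (1 + z / E)"
        unfolding v_def using nz by (simp add: diff_divide_distrib)
      also have "E * (1 + z / E) - (1 + z * E) / E = E - 1 / E"
        using E0 by (simp add: field_simps)
      finally show ?thesis .
    qed
    ultimately have "\<psi> w = z"
      unfolding \<psi>_def u using nz s by (simp add: Es)
    then show "z \<in> \<psi> ` {w. Re w \<in> X}" using w by auto
  qed
  have D: "(\<psi> has_field_derivative \<psi>' w) (at w)" if w: "Re w \<in> X" for w
  proof -
    have u': "(u has_field_derivative 2 * \<i> * of_real s * u w) (at w)"
      unfolding u_def by (auto intro!: derivative_eq_intros)
    have "(\<psi> has_field_derivative ((2 * \<i> * of_real s * u w - 0) * (E - u w / E) - (u w - 1) * (0 - 2 * \<i> * of_real s * u w / E))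
        / ((E - u w / E) * (E - u w / E))) (at w)"
      unfolding \<psi>_def[abs_def]
      by (intro DERIV_divide DERIV_diff u' DERIV_const DERIV_cdivide strip(2) w)
    moreover have "(2 * \<i> * of_real s * u w - 0) * (E - u w / E) - (u w - 1) * (0 - 2 * \<i> * of_real s * u w / E)
        = 2 * \<i> * of_real s * u w * (E - 1 / E)"
      using E0 by (simp add: field_simps)
    ultimately show ?thesis
      unfolding Es \<psi>'_def by (simp add: power2_eq_square mult_ac)
  qed
  have W\<psi>: "W w * \<psi>' w = \<psi> w" if w: "Re w \<in> X" for w
  proof -
    have u0: "u w \<noteq> 0" by (simp add: u_def)
    define d where "d = E - u w / E"
    have d: "d \<noteq> 0" using strip(2)[OF w] by (simp add: d_def)
    have "exp (\<i> * (2 * of_real s * w - of_real \<beta>)) = u w / E"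
      by (simp add: u_def E_def right_diff_distrib exp_diff mult_ac)
    moreover from this have "exp (- (\<i> * (2 * of_real s * w - of_real \<beta>))) = E / u w"
      by (simp only: exp_minus) simp
    ultimately have "cos (2 * of_real s * w - of_real \<beta>) = (u w / E + E / u w) / 2"
      by (simp add: cos_exp_eq)
    then have "W w = (u w / E + E / u w - (E + 1 / E)) / (4 * (of_real s)\<^sup>2)"
      unfolding W_def Ec by (simp only:) (simp add: diff_divide_distrib add_divide_distrib mult.left_commute)
    then have "W w * (4 * (of_real s)\<^sup>2) = u w / E + E / u w - (E + 1 / E)"
      using s by simp
    moreover have "W w * \<psi>' w = - ((W w * (4 * (of_real s)\<^sup>2)) * u w) / d\<^sup>2"
      unfolding \<psi>'_def d_def[symmetric] by simp
    ultimately have "W w * \<psi>' w = - ((u w / E + E / u w - (E + 1 / E)) * u w) / d\<^sup>2"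
      by (simp only:)
    also have "(u w / E + E / u w - (E + 1 / E)) * u w = - ((u w - 1) * d)"
      using u0 E0 by (simp add: d_def field_simps)
    finally show ?thesis using d by (simp add: \<psi>_def d_def[symmetric] power2_eq_square)
  qed
  have W: "(W has_field_derivative W' w) (at w)" for w
    unfolding W_def[abs_def] W'_def using s
    by (auto intro!: derivative_eq_intros simp: power2_eq_square field_simps)
  \<comment> \<open>On the strip \<open>\<beta> - 2 * s * x\<close> stays between 0 and
    \<open>pi\<close>.\<close>
  have sin_neg: "sin (2 * s * x - \<beta>) < 0" if "x \<in> X" for x
  proof -
    have "0 < \<beta> - 2 * s * x" "\<beta> - 2 * s * x < pi"
      using that s by (auto simp: X_def field_simps)
    then have "sin (\<beta> - 2 * s * x) > 0" by (rule sin_gt_zero)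
    then show ?thesis using sin_minus[of "\<beta> - 2 * s * x"] by simp
  qed
  have W'pos: "Re (W' w) > 0" if "Re w \<in> X" for w
  proof -
    have "Re (W' w) = - sin (2 * s * Re w - \<beta>) * (exp (2 * s * Im w) + exp (- (2 * s * Im w))) / 2 / s"
      by (simp add: W'_def Re_sin)
    also have "\<dots> > 0"
      using sin_neg[OF that] s by (intro divide_pos_pos mult_pos_pos add_pos_pos) auto
    finally show ?thesis .
  qed
  have ImW: "Im (W (Complex x y)) = - sin (2 * s * x - \<beta>) / (4 * s\<^sup>2) * (exp ((2 * s) * y) - exp (- ((2 * s) * y)))" for x y
  proof -
    have "W (Complex x y) = (cos (2 * of_real s * Complex x y - of_real \<beta>) - of_real (cos \<beta>)) / of_real (2 * s\<^sup>2)"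
      by (simp add: W_def)
    then have "Im (W (Complex x y)) = Im (cos (2 * of_real s * Complex x y - of_real \<beta>)) / (2 * s\<^sup>2)"
      by (simp only: Im_divide_of_real) simp
    also have "\<dots> = - sin (2 * s * x - \<beta>) / (4 * s\<^sup>2) * (exp ((2 * s) * y) - exp (- ((2 * s) * y)))"
      using s by (simp add: Im_cos field_simps)
    finally show ?thesis .
  qed
  show ?thesis
  proof (rule convolution_in_strip_coordinate[where X=X and \<psi>=\<psi> and W=W and W'=W' and a=a and l=1,
      OF _ _ surj D W\<psi> W W'pos _ _ SH _ _ \<epsilon> n dil \<mu> a h1 g1])
    show "open X" "is_interval X" by (auto simp: X_def is_interval_1)
    show "LIM y at_top. Im (W (Complex x y)) :> at_top"
      "LIM y at_bot. Im (W (Complex x y)) :> at_bot" if "x \<in> X" for x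
    proof -
      have c: "0 < - sin (2 * s * x - \<beta>) / (4 * s\<^sup>2)" and k: "0 < 2 * s"
        using sin_neg[OF that] s by (auto intro!: divide_neg_pos)
      show "LIM y at_top. Im (W (Complex x y)) :> at_top" "LIM y at_bot. Im (W (Complex x y)) :> at_bot"
        unfolding ImW by (rule filterlim_exp_diff_at_infinity[OF c k])+
    qed
  qed (use sh \<alpha> in auto)
qed

section \<open>Reduction of the given data to the two cases\<close>

theorem theorem5:
  fixes a1 :: complex and \<gamma>1 \<gamma>2 \<theta> :: real and n :: nat
    and h1 g1 h2 g2 :: "complex \<Rightarrow> complex"
  defines "a1' \<equiv> norm (1 + a1) - 1"
  defines "\<gamma>a \<equiv> Arg (1 + cnj a1)"
  assumes a1: "a1 \<in> ball 0 1"
    and g1: "0 \<le> \<gamma>1" "\<gamma>1 < 2 * pi"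
    and g2: "0 \<le> \<gamma>2" "\<gamma>2 < 2 * pi"
    and f1_SH: "in_SH h1 g1"
    and f1_img: "harm h1 g1 ` ball 0 1 = halfplane_H a1 \<gamma>1"
    and f1_shear: "\<forall>z\<in>ball 0 1. h1 z + exp (- 2 * \<i> * of_real (\<gamma>1 + \<gamma>a)) * g1 z
                      = (1 + of_real a1') * z / (1 - exp (\<i> * of_real (\<gamma>1 + \<gamma>a)) * z)"
    and f1_dil: "\<forall>z\<in>ball 0 1. dilatation h1 g1 z
                   = exp (2 * \<i> * of_real (\<gamma>1 + \<gamma>a)) *
                     ((of_real a1' - z * exp (\<i> * of_real (\<gamma>1 + \<gamma>a))) /
                      (1 - of_real a1' * z * exp (\<i> * of_real (\<gamma>1 + \<gamma>a))))"
    and h2: "h2 holomorphic_on ball 0 1" and g2h: "g2 holomorphic_on ball 0 1"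
    and f2_lu: "locally_univalent (harm h2 g2) (ball 0 1)"
    and f2_dil: "\<forall>z\<in>ball 0 1. dilatation h2 g2 z = exp (\<i> * of_real \<theta>) * z ^ n"
    and n: "n \<ge> 1"
    and a1_range: "2 * real n / (real n + 2) \<le> norm (1 + a1)" "norm (1 + a1) < 2"
  shows "(in_SH h2 g2 \<and> harm h2 g2 ` ball 0 1 = halfplane_H 0 \<gamma>2 \<and>
            (\<forall>z\<in>ball 0 1. h2 z + exp (- 2 * \<i> * of_real \<gamma>2) * g2 z
                = z / (1 - exp (\<i> * of_real \<gamma>2) * z))
          \<longrightarrow> inj_on (harm_conv h1 g1 h2 g2) (ball 0 1) \<and>
              convex_in_direction (harm_conv h1 g1 h2 g2) (ball 0 1) (- (\<gamma>1 + \<gamma>a + \<gamma>2)))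
       \<and> (\<forall>\<beta>. 0 < \<beta> \<and> \<beta> < pi \<and> in_SH h2 g2 \<and> harm h2 g2 ` ball 0 1 = strip_Omega \<beta> \<and>
            (\<forall>z\<in>ball 0 1. h2 z + g2 z
                = 1 / (2 * \<i> * of_real (sin \<beta>)) *
                  Ln ((1 + z * exp (\<i> * of_real \<beta>)) / (1 + z * exp (- \<i> * of_real \<beta>))))
          \<longrightarrow> inj_on (harm_conv h1 g1 h2 g2) (ball 0 1) \<and>
              convex_in_direction (harm_conv h1 g1 h2 g2) (ball 0 1) (- (\<gamma>1 + \<gamma>a)))"
proof -
  define \<mu> where "\<mu> = exp (\<i> * complex_of_real (\<gamma>1 + \<gamma>a))"
  define \<epsilon> where "\<epsilon> = exp (\<i> * complex_of_real \<theta>)"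
  have \<mu>: "norm \<mu> = 1" and \<epsilon>: "norm \<epsilon> = 1" by (simp_all add: \<mu>_def \<epsilon>_def)
  have exp_sq: "exp (2 * \<i> * of_real t) = (exp (\<i> * of_real t))\<^sup>2"
    and exp_inv_sq: "exp (- 2 * \<i> * of_real t) = 1 / (exp (\<i> * of_real t))\<^sup>2" for t
    by (simp_all add: exp_double[symmetric] exp_minus inverse_eq_divide mult_ac)
  \<comment> \<open>A positive lower bound for \<open>norm (1 + a1)\<close> gives
    \<open>a1' > -1\<close>, and the upper bound 2 gives \<open>a1' < 1\<close>.\<close>
  have "0 < 2 * real n / (real n + 2)" using n by simp
  with a1_range have a: "-1 < a1'" "a1' < 1" unfolding a1'_def by linarith+
  have range: "2 * real n / (real n + 2) \<le> 1 + a1'" using a1_range by (simp add: a1'_def)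
  have hol: "h1 holomorphic_on ball 0 1" "g1 holomorphic_on ball 0 1" "h1 0 = 0" "g1 0 = 0"
    using f1_SH by (auto simp: in_SH_def)
  have dh: "deriv h1 z \<noteq> 0" if "norm z < 1" for z
    using f1_SH that norm_ge_zero[of "deriv g1 z"] by (force simp: in_SH_def)
  have shear: "h1 z + g1 z / \<mu>\<^sup>2 = (1 + of_real a1') * z / (1 - \<mu> * z)" if "norm z < 1" for z
    using f1_shear that unfolding exp_inv_sq \<mu>_def[symmetric] by simp
  have dil1: "dilatation h1 g1 z = \<mu>\<^sup>2 * ((of_real a1' - \<mu> * z) / (1 - of_real a1' * (\<mu> * z)))" if "norm z < 1" for z
    using f1_dil that unfolding exp_sq \<mu>_def[symmetric] by (simp add: mult_ac)
  note f1 = halfplane_shear_explicit[OF \<mu> a hol dh shear dil1]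
  have dil2: "dilatation h2 g2 z = \<epsilon> * z ^ n" if "norm z < 1" for z
    using f2_dil that by (simp add: \<epsilon>_def)
  show ?thesis
  proof (intro conjI[of "_ \<longrightarrow> _"] impI allI, elim conjE)
    assume SH: "in_SH h2 g2" and sh: "\<forall>z\<in>ball 0 1. h2 z + exp (- 2 * \<i> * of_real \<gamma>2) * g2 z
                = z / (1 - exp (\<i> * of_real \<gamma>2) * z)"
    show "inj_on (harm_conv h1 g1 h2 g2) (ball 0 1) \<and>
              convex_in_direction (harm_conv h1 g1 h2 g2) (ball 0 1) (- (\<gamma>1 + \<gamma>a + \<gamma>2))"
    \<comment> \<open>This \<open>l\<close> brings the given shear to the form
      \<open>h2 + g2 / l\<^sup>2\<close>; together with \<open>\<mu>\<close> it accounts for the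
      angle \<open>\<gamma>1 + \<gamma>a + \<gamma>2\<close>.\<close>
    proof (rule convolution_halfplane[where l = "exp (\<i> * of_real \<gamma>2)", OF SH _ _ \<epsilon> n dil2 \<mu> a(2) range f1])
      show "h2 z + g2 z / (exp (\<i> * of_real \<gamma>2))\<^sup>2 = z / (1 - exp (\<i> * of_real \<gamma>2) * z)" if "norm z < 1" for z
        using sh that unfolding exp_inv_sq by simp
      have "exp (\<i> * of_real (- (\<gamma>1 + \<gamma>a + \<gamma>2))) = exp (- (\<i> * of_real (\<gamma>1 + \<gamma>a) + \<i> * of_real \<gamma>2))"
        by (simp add: algebra_simps)
      then show "exp (\<i> * of_real (- (\<gamma>1 + \<gamma>a + \<gamma>2))) = 1 / (\<mu> * exp (\<i> * of_real \<gamma>2))"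
        unfolding \<mu>_def exp_minus exp_add by (simp add: inverse_eq_divide)
    qed auto
  next
    fix \<beta> assume H: "0 < \<beta> \<and> \<beta> < pi \<and> in_SH h2 g2 \<and> harm h2 g2 ` ball 0 1 = strip_Omega \<beta> \<and>
            (\<forall>z\<in>ball 0 1. h2 z + g2 z
                = 1 / (2 * \<i> * of_real (sin \<beta>)) *
                  Ln ((1 + z * exp (\<i> * of_real \<beta>)) / (1 + z * exp (- \<i> * of_real \<beta>))))"
    then have SH: "in_SH h2 g2" and \<beta>: "0 < \<beta>" "\<beta> < pi" and img: "harm h2 g2 ` ball 0 1 = strip_Omega \<beta>"
      by auto
    have "exp (\<i> * of_real (- (\<gamma>1 + \<gamma>a))) = exp (- (\<i> * of_real (\<gamma>1 + \<gamma>a)))"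
      by (simp only: of_real_minus mult_minus_right)
    then have \<alpha>: "exp (\<i> * of_real (- (\<gamma>1 + \<gamma>a))) = 1 / \<mu>"
      unfolding \<mu>_def exp_minus by (simp add: inverse_eq_divide)
    show "inj_on (harm_conv h1 g1 h2 g2) (ball 0 1) \<and>
              convex_in_direction (harm_conv h1 g1 h2 g2) (ball 0 1) (- (\<gamma>1 + \<gamma>a))"
      by (rule convolution_strip[OF SH \<beta> img _ \<epsilon> n dil2 \<mu> a(2) range f1 \<alpha>]) (use H in auto)
  qed
qed

end
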